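(* Let $\mathcal A$ be a cluster algebra of full rank and let $S=\operatorname{diag}(s_1,\ldots,s_n)$ be a fixed skew-symmetrizer for the exchange matrices of $\mathcal A$. Let $u$ and $u'$ be two good elements in $\mathcal A$. Then the following statements hold. (i) For any two vertices $t,t'$ of $\mathbb T_n$ joined by an edge labelled $k$, we have $$F_u^{t'}[S({\bf g}_{u'}^{t'})^\circ]-F_u^t[S({\bf g}_{u'}^t)^\circ]=s_k\bigl([-g_{k;u}^{t'}]_+[-g_{k;u'}^{t}]_+-[-g_{k;u}^t]_+[-g_{k;u'}^{t'}]_+\bigr).$$ (ii) For any two vertices $t,t'\in\mathbb T_n$, we have $$F_u^t[S({\bf g}_{u'}^t)^\circ]+F_{u'}^t[S({\bf g}_u^t)^\circ]=F_u^{t'}[S({\bf g}_{u'}^{t'})^\circ]+F_{u'}^{t'}[S({\bf g}_u^{t'})^\circ].$$ In particular, the $F$-invariant $(u\mid\mid u')_F=F_u^t[S({\bf g}_{u'}^t)^\circ]+F_{u'}^t[S({\bf g}_u^t)^\circ]$ only depends on $u$ and $u'$, not on the choice of the vertex $t\in\mathbb T_n$.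
   Context: Fix integers $m\ge n>0$; write $[a]_+=\max(a,0)$. $\mathbb F$ is the field of rational functions over $\mathbb Q$ in $m$ variables. $\mathbb T_n$ is the $n$-regular tree with edges labelled by $1,\dots,n$ so that the $n$ edges at each vertex have distinct labels. Cluster algebras. A seed is a pair $({\bf x},\widetilde B)$ where ${\bf x}=(x_1,\dots,x_m)$ is an ordered set of free generators of $\mathbb F$ over $\mathbb Q$ and $\widetilde B=(b_{ij})$ is an $m\times n$ integer matrix whose top $n\times n$ part $B$ (the exchange matrix) is skew-symmetrizable: there is $S=\operatorname{diag}(s_1,\dots,s_n)$ with positive integer entries (a skew-symmetrizer) with $SB$ skew-symmetric. Its mutation in direction $k\in\{1,\dots,n\}$ is $({\bf x}',\widetilde B')$ with $x_i'=x_i$ for $i\ne k$, $x_k'=x_k^{-1}\bigl(\prod_j x_j^{[b_{jk}]_+}+\prod_j x_j^{[-b_{jk}]_+}\bigr)$, $b'_{ij}=-b_{ij}$ if $i=k$ or $j=k$, and $b'_{ij}=b_{ij}+[b_{ik}]_+[b_{kj}]_+-[-b_{ik}]_+[-b_{kj}]_+$ otherwise. A cluster pattern assigns a seed $({\bf x}_t,\widetilde B_t)$, ${\bf x}_t=(x_{1;t},\dots,x_{m;t})$, $\widetilde B_t=(b_{ij;t})$, to each vertex $t\in\mathbb T_n$ so that seeds joined by an edge labelled $k$ are mutations of each other in direction $k$. All exchange matrices $B_t$ share the same skew-symmetrizers. The cluster algebra $\mathcal A$ is the $\mathbb Z$-subalgebra of $\mathbb F$ generated by all $x_{i;t}$ (frozen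 variables $x_{n+1},\dots,x_m$ are not inverted). It is of full rank if $\widetilde B_t$ has rank $n$ for one (equivalently every) $t$. Put $\hat y_{k;t}=\prod_{j=1}^m x_{j;t}^{b_{jk;t}}$. Good elements ($\mathcal A$ of full rank). An element $u\in\mathcal A$ is pointed at $t$ if $u={\bf x}_t^{{\bf g}}F(\hat y_{1;t},\dots,\hat y_{n;t})$ for some ${\bf g}\in\mathbb Z^m$ and some $F\in\mathbb Z[y_1,\dots,y_n]$ with constant term $1$; these are then unique and denoted ${\bf g}_u^t=(g_{1;u}^t,\dots,g_{m;u}^t)^T$ (extended $g$-vector) and $F_u^t$ ($F$-polynomial). $({\bf g}_u^t)^\circ=(g_{1;u}^t,\dots,g_{n;u}^t)^T\in\mathbb Z^n$ is the $g$-vector. $u$ is compatibly pointed if it is pointed at every $t\in\mathbb T_n$ and, for every edge labelled $k$ joining $t,t'$, one has $g_{k;u}^{t'}=-g_{k;u}^t$ and $g_{i;u}^{t'}=g_{i;u}^t+[-b_{ik;t}]_+g_{k;u}^t+b_{ik;t}[g_{k;u}^t]_+$ for $i\neq k$. $u$ is good if it is compatibly pointed and $u\in\mathbb Z_{\ge0}[x_{1;t}^{\pm1},\dots,x_{m;t}^{\pm1}]$ for every $t$. Tropical polynomial. For a non-zero $F=\sum_{\bf v}c_{\bf v}{\bf y}^{\bf v}\in\mathbb Z[y_1,\dots,y_n]$ and ${\bf r}\in\mathbb Z^n$, $F[{\bf r}]=\max\{{\bf v}^T{\bf r}\mid c_{\bf v}\ne0\}$. *)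

theory Defs
  imports
    "HOL-Library.Poly_Mapping"
    "Jordan_Normal_Form.DL_Rank"
    "Graph_Theory.Graph_Theory"
begin

text \<open>
  All indices start at 0: cluster variables are numbered \<open>0, ..., m - 1\<close>, the mutable ones and the
  edge labels \<open>0, ..., n - 1\<close>.  Polynomials in the variables \<open>0, 1, ...\<close> with coefficients in \<open>'c\<close>
  are finitely supported maps from exponents to coefficients, \<open>(nat \<Rightarrow>\<^sub>0 nat) \<Rightarrow>\<^sub>0 'c\<close>.
\<close>

abbreviation pos :: "int \<Rightarrow> int"
  where "pos a \<equiv> max a 0"

definition poly_in :: "nat \<Rightarrow> ((nat \<Rightarrow>\<^sub>0 nat) \<Rightarrow>\<^sub>0 'c::zero) \<Rightarrow> bool"
  where "poly_in n p \<longleftrightarrow> (\<forall>v \<in> Poly_Mapping.keys p. Poly_Mapping.keys v \<subseteq> {..<n})"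

text \<open>The argument \<open>\<phi>\<close> embeds the coefficients into the field.\<close>

definition poly_eval :: "('c::zero \<Rightarrow> 'f::field) \<Rightarrow> 'f vec \<Rightarrow> ((nat \<Rightarrow>\<^sub>0 nat) \<Rightarrow>\<^sub>0 'c) \<Rightarrow> 'f"
  where "poly_eval \<phi> y p =
    (\<Sum>v \<in> Poly_Mapping.keys p.
      \<phi> (Poly_Mapping.lookup p v) * (\<Prod>i<dim_vec y. y $ i ^ Poly_Mapping.lookup v i))"

definition monomial :: "'f::field vec \<Rightarrow> int vec \<Rightarrow> 'f"
  where "monomial x g = (\<Prod>i<dim_vec g. x $ i powi (g $ i))"


section \<open>Seeds and mutations\<close>

text \<open>
  The ambient field of rational functions is the whole type \<open>'f\<close>: if \<open>free_generators m x\<close> holds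
  for some \<open>x\<close>, then \<open>'f\<close> is (isomorphic to) the field of rational functions over the rationals in
  \<open>m\<close> variables.
\<close>

definition free_generators :: "nat \<Rightarrow> 'f::field_char_0 vec \<Rightarrow> bool"
  where "free_generators m x \<longleftrightarrow> x \<in> carrier_vec m \<and>
    (\<forall>p. poly_in m p \<and> poly_eval of_rat x p = 0 \<longrightarrow> p = 0) \<and>
    (\<forall>f. \<exists>p q. poly_in m p \<and> poly_in m q \<and> poly_eval of_rat x q \<noteq> 0 \<and>
           f = poly_eval of_rat x p / poly_eval of_rat x q)"

datatype 'f seed = Seed (cluster: "'f vec") (ext_matrix: "int mat")

definition exchange_matrix :: "'f seed \<Rightarrow> int mat"
  where "exchange_matrix s =
    mat (dim_col (ext_matrix s)) (dim_col (ext_matrix s)) (\<lambda>ij. ext_matrix s $$ ij)"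

definition skew_symmetrizer :: "int mat \<Rightarrow> int mat \<Rightarrow> bool"
  where "skew_symmetrizer S B \<longleftrightarrow>
    S \<in> carrier_mat (dim_row B) (dim_row B) \<and> diagonal_mat S \<and>
    (\<forall>i<dim_row B. S $$ (i, i) > 0) \<and> transpose_mat (S * B) = - (S * B)"

definition is_seed :: "nat \<Rightarrow> nat \<Rightarrow> 'f::field_char_0 seed \<Rightarrow> bool"
  where "is_seed m n s \<longleftrightarrow> free_generators m (cluster s) \<and> ext_matrix s \<in> carrier_mat m n \<and>
    (\<exists>S. skew_symmetrizer S (exchange_matrix s))"

definition mutate :: "nat \<Rightarrow> 'f::field_char_0 seed \<Rightarrow> 'f seed"
  where "mutate k s = (let x = cluster s; B = ext_matrix s in Seed
    (vec (dim_vec x) (\<lambda>i. if i = k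
       then inverse (x $ k) * ((\<Prod>j<dim_vec x. x $ j powi pos (B $$ (j, k)))
                             + (\<Prod>j<dim_vec x. x $ j powi pos (- B $$ (j, k))))
       else x $ i))
    (mat (dim_row B) (dim_col B) (\<lambda>(i, j). if i = k \<or> j = k
       then - B $$ (i, j)
       else B $$ (i, j) + pos (B $$ (i, k)) * pos (B $$ (k, j))
                        - pos (- B $$ (i, k)) * pos (- B $$ (k, j)))))"


section \<open>Cluster patterns and cluster algebras\<close>

text \<open>
  Undirected graphs are symmetric digraphs, with an edge represented by its two opposite arcs.
  The library's \<open>tree\<close> is of no use here, because its \<open>cycle\<close> includes the walk \<open>a, b, a\<close> along an
  edge and back; the undirected cycles are those of length at least 3.
\<close>

definition labelled_regular_tree :: "nat \<Rightarrow> 'v pair_pre_digraph \<Rightarrow> ('v \<times> 'v \<Rightarrow> nat) \<Rightarrow> bool"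
  where "labelled_regular_tree n T lab \<longleftrightarrow>
    sym_digraph (with_proj T) \<and> loopfree_digraph (with_proj T) \<and>
    Digraph_Component.connected (with_proj T) \<and>
    \<not> (\<exists>p. pre_digraph.cycle (with_proj T) p \<and> 3 \<le> length p) \<and>
    (\<forall>t t'. (t, t') \<in> parcs T \<longrightarrow> lab (t', t) = lab (t, t')) \<and>
    (\<forall>t \<in> pverts T. bij_betw lab (out_arcs (with_proj T) t) {..<n})"

definition cluster_pattern ::
    "nat \<Rightarrow> nat \<Rightarrow> 'v pair_pre_digraph \<Rightarrow> ('v \<times> 'v \<Rightarrow> nat) \<Rightarrow> ('v \<Rightarrow> 'f::field_char_0 seed) \<Rightarrow> bool"
  where "cluster_pattern m n T lab X \<longleftrightarrow> labelled_regular_tree n T lab \<and>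
    (\<forall>t \<in> pverts T. is_seed m n (X t)) \<and>
    (\<forall>t t'. (t, t') \<in> parcs T \<longrightarrow> X t' = mutate (lab (t, t')) (X t))"

definition is_subring :: "'f::ring_1 set \<Rightarrow> bool"
  where "is_subring R \<longleftrightarrow> 1 \<in> R \<and> (\<forall>a \<in> R. \<forall>b \<in> R. a - b \<in> R \<and> a * b \<in> R)"

definition cluster_algebra :: "'v pair_pre_digraph \<Rightarrow> ('v \<Rightarrow> 'f::field_char_0 seed) \<Rightarrow> 'f set"
  where "cluster_algebra T X =
    is_subring hull {cluster (X t) $ i | t i. t \<in> pverts T \<and> i < dim_vec (cluster (X t))}"

definition full_rank :: "'v pair_pre_digraph \<Rightarrow> ('v \<Rightarrow> 'f seed) \<Rightarrow> bool"
  where "full_rank T X \<longleftrightarrow> (\<exists>t \<in> pverts T.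
    vec_space.rank (dim_row (ext_matrix (X t))) (map_mat rat_of_int (ext_matrix (X t)))
      = dim_col (ext_matrix (X t)))"


section \<open>Good elements\<close>

definition y_hat :: "'f::field_char_0 seed \<Rightarrow> 'f vec"
  where "y_hat s = vec (dim_col (ext_matrix s)) (\<lambda>k. monomial (cluster s) (col (ext_matrix s) k))"

definition pointed_with ::
    "'f::field_char_0 seed \<Rightarrow> 'f \<Rightarrow> int vec \<Rightarrow> ((nat \<Rightarrow>\<^sub>0 nat) \<Rightarrow>\<^sub>0 int) \<Rightarrow> bool"
  where "pointed_with s u g F \<longleftrightarrow>
    g \<in> carrier_vec (dim_row (ext_matrix s)) \<and> poly_in (dim_col (ext_matrix s)) F \<and>
    Poly_Mapping.lookup F 0 = 1 \<and> u = monomial (cluster s) g * poly_eval of_int (y_hat s) F"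

definition pointed :: "'f::field_char_0 seed \<Rightarrow> 'f \<Rightarrow> bool"
  where "pointed s u \<longleftrightarrow> (\<exists>g F. pointed_with s u g F)"

text \<open>
  The following two are meaningful if \<open>u\<close> is pointed at \<open>s\<close> and the extended exchange matrix has
  full rank, in which case \<open>g\<close> and \<open>F\<close> are unique.
\<close>

definition ext_g_vector :: "'f::field_char_0 seed \<Rightarrow> 'f \<Rightarrow> int vec"
  where "ext_g_vector s u = (THE g. \<exists>F. pointed_with s u g F)"

definition F_polynomial :: "'f::field_char_0 seed \<Rightarrow> 'f \<Rightarrow> ((nat \<Rightarrow>\<^sub>0 nat) \<Rightarrow>\<^sub>0 int)"
  where "F_polynomial s u = (THE F. \<exists>g. pointed_with s u g F)"

definition g_vector :: "'f::field_char_0 seed \<Rightarrow> 'f \<Rightarrow> int vec"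
  where "g_vector s u = vec_first (ext_g_vector s u) (dim_col (ext_matrix s))"

definition compatibly_pointed ::
    "'v pair_pre_digraph \<Rightarrow> ('v \<times> 'v \<Rightarrow> nat) \<Rightarrow> ('v \<Rightarrow> 'f::field_char_0 seed) \<Rightarrow> 'f \<Rightarrow> bool"
  where "compatibly_pointed T lab X u \<longleftrightarrow> u \<in> cluster_algebra T X \<and>
    (\<forall>t \<in> pverts T. pointed (X t) u) \<and>
    (\<forall>t t' k. (t, t') \<in> parcs T \<and> lab (t, t') = k \<longrightarrow>
      (let B = ext_matrix (X t); g = ext_g_vector (X t) u; g' = ext_g_vector (X t') u in
        g' $ k = - g $ k \<and>
        (\<forall>i<dim_row B. i \<noteq> k \<longrightarrow>
          g' $ i = g $ i + pos (- B $$ (i, k)) * g $ k + B $$ (i, k) * pos (g $ k))))"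

text \<open>
  Laurent polynomials with non-negative integer coefficients are finitely supported maps from
  exponents in the integers to coefficients in \<open>nat\<close>.
\<close>

definition positive_Laurent :: "'f::field_char_0 vec \<Rightarrow> 'f \<Rightarrow> bool"
  where "positive_Laurent x u \<longleftrightarrow> (\<exists>P :: (nat \<Rightarrow>\<^sub>0 int) \<Rightarrow>\<^sub>0 nat.
    u = (\<Sum>e \<in> Poly_Mapping.keys P.
      of_nat (Poly_Mapping.lookup P e) * (\<Prod>i<dim_vec x. x $ i powi Poly_Mapping.lookup e i)))"

definition good ::
    "'v pair_pre_digraph \<Rightarrow> ('v \<times> 'v \<Rightarrow> nat) \<Rightarrow> ('v \<Rightarrow> 'f::field_char_0 seed) \<Rightarrow> 'f \<Rightarrow> bool"
  where "good T lab X u \<longleftrightarrow> compatibly_pointed T lab X u \<and>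
    (\<forall>t \<in> pverts T. positive_Laurent (cluster (X t)) u)"


section \<open>Tropical polynomials and the F-invariant\<close>

definition trop :: "((nat \<Rightarrow>\<^sub>0 nat) \<Rightarrow>\<^sub>0 int) \<Rightarrow> int vec \<Rightarrow> int"
  where "trop F r =
    Max ((\<lambda>v. \<Sum>k<dim_vec r. int (Poly_Mapping.lookup v k) * r $ k) ` Poly_Mapping.keys F)"

definition F_invariant :: "int mat \<Rightarrow> 'f::field_char_0 seed \<Rightarrow> 'f \<Rightarrow> 'f \<Rightarrow> int"
  where "F_invariant S s u u' =
    trop (F_polynomial s u) (S *\<^sub>v g_vector s u') + trop (F_polynomial s u') (S *\<^sub>v g_vector s u)"

end

theory Submission
  imports Defs "HOL-Library.Multiset" "Jordan_Normal_Form.Matrix_Kernel"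
begin

text \<open>
  Let \<open>t\<close> and \<open>t'\<close> be joined by an edge labelled \<open>k\<close>.  Comparing the two pointed expressions of \<open>u\<close>
  gives \<open>F(y) = y\<^sub>k ^ pos g\<^sub>k * (1 + y\<^sub>k) ^ (- g\<^sub>k) * F'(y')\<close>, where \<open>y\<close> and \<open>y'\<close> are the \<open>y_hat\<close>
  variables at the two seeds and \<open>g\<close> is the g-vector of \<open>u\<close> at \<open>t\<close>.  By positivity both sides are
  subtraction-free in \<open>y\<close>, and since the \<open>y\<^sub>j\<close> are algebraically independent (full rank) the
  identity may be tropicalized at
  \<open>r = S h\<close>, with \<open>h\<close> the g-vector of \<open>u'\<close> at \<open>t\<close>.  The skew-symmetry of \<open>S B\<close> turns the
  tropical mutation of \<open>r\<close> into the mutation of g-vectors, so that \<open>y'\<close> takes the tropical value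
  \<open>S h'\<close>; this is (i).  The right-hand side of (i) is antisymmetric in \<open>u\<close> and \<open>u'\<close>, hence the
  F-invariant is constant along edges.
\<close>

section \<open>Laurent monomials\<close>

lemma power_int_sum:
  fixes a :: "'a::field"
  assumes "a \<noteq> 0"
  shows "a powi (\<Sum>i\<in>I. f i) = (\<Prod>i\<in>I. a powi f i)"
  using assms by (induction I rule: infinite_finite_induct) (auto simp: power_int_add)

lemma prod_power_int:
  fixes f :: "'b \<Rightarrow> 'a::field"
  shows "(\<Prod>i\<in>I. f i) powi k = (\<Prod>i\<in>I. f i powi k)"
  by (induction I rule: infinite_finite_induct) (auto simp: power_int_mult_distrib)

lemma monomial_0 [simp]: "monomial x (0\<^sub>v m) = 1"
  by (simp add: monomial_def)

lemma monomial_unit: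
  assumes "i < n"
  shows "monomial x (unit_vec n i) = x $ i"
proof -
  have "monomial x (unit_vec n i) = (\<Prod>j<n. if j = i then x $ i else 1)"
    unfolding monomial_def using assms by (intro prod.cong) auto
  also have "\<dots> = x $ i"
    using assms by simp
  finally show ?thesis .
qed

context
  fixes x :: "'f::field vec" and m :: nat
  assumes x_nonzero: "\<And>i. i < m \<Longrightarrow> x $ i \<noteq> 0"
begin

lemma monomial_nonzero:
  assumes "g \<in> carrier_vec m"
  shows "monomial x g \<noteq> 0"
  using assms x_nonzero by (auto simp: monomial_def)

lemma monomial_add:
  assumes "g \<in> carrier_vec m" "h \<in> carrier_vec m"
  shows "monomial x (g + h) = monomial x g * monomial x h"
proof -
  have "monomial x (g + h) = (\<Prod>i<m. x $ i powi (g $ i) * x $ i powi (h $ i))"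
    unfolding monomial_def using assms x_nonzero
    by (intro prod.cong) (auto simp: power_int_add)
  then show ?thesis
    using assms by (simp add: monomial_def prod.distrib)
qed

lemma monomial_smult:
  assumes "g \<in> carrier_vec m"
  shows "monomial x (k \<cdot>\<^sub>v g) = monomial x g powi k"
proof -
  have "monomial x (k \<cdot>\<^sub>v g) = (\<Prod>i<m. (x $ i powi (g $ i)) powi k)"
    unfolding monomial_def using assms
    by (intro prod.cong) (auto simp: mult.commute[of k] power_int_mult)
  then show ?thesis
    using assms by (simp add: monomial_def prod_power_int)
qed

text \<open>Exchanging the two products collects the exponent \<open>(B *\<^sub>v v) $ i\<close> at
  every \<open>x $ i\<close>. When \<open>B\<close> is the extended exchange matrix, the inner
  vector is \<open>y_hat\<close>, so questions about \<open>y_hat\<close> become questions about the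
  cluster.\<close>

lemma monomial_mult_mat_vec:
  assumes B: "B \<in> carrier_mat m n" and v: "v \<in> carrier_vec n"
  shows "monomial (vec n (\<lambda>k. monomial x (col B k))) v = monomial x (B *\<^sub>v v)"
proof -
  have "monomial (vec n (\<lambda>k. monomial x (col B k))) v
      = (\<Prod>k<n. \<Prod>i<m. x $ i powi (B $$ (i, k) * v $ k))"
    unfolding monomial_def using B v
    by (intro prod.cong) (auto simp: prod_power_int power_int_mult intro!: prod.cong)
  also have "\<dots> = (\<Prod>i<m. \<Prod>k<n. x $ i powi (B $$ (i, k) * v $ k))"
    by (rule prod.swap)
  also have "\<dots> = monomial x (B *\<^sub>v v)"
    unfolding monomial_def using B v x_nonzero
    by (intro prod.cong)
      (auto simp: scalar_prod_def atLeast0LessThan power_int_sum intro!: prod.cong)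
  finally show ?thesis .
qed

end

section \<open>Linear independence of Laurent monomials in free generators\<close>

lemma free_generators_nonzero:
  assumes "free_generators m x" "i < m"
  shows "x $ i \<noteq> 0"
proof
  assume 0: "x $ i = 0"
  let ?p = "Poly_Mapping.single (Poly_Mapping.single i 1) 1 :: (nat \<Rightarrow>\<^sub>0 nat) \<Rightarrow>\<^sub>0 rat"
  have x: "x \<in> carrier_vec m"
    using assms by (simp add: free_generators_def)
  have "(\<Prod>j<m. x $ j ^ Poly_Mapping.lookup (Poly_Mapping.single i 1) j) = 0"
    using assms(2) 0 by (intro prod_zero) (auto simp: intro!: bexI[of _ i])
  then have "poly_eval of_rat x ?p = 0"
    using x by (simp add: poly_eval_def)
  moreover have "poly_in m ?p"
    using assms(2) by (simp add: poly_in_def)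
  ultimately have "?p = 0"
    using assms(1) unfolding free_generators_def by blast
  then show False
    by (metis keys_zero keys_single zero_neq_one insert_not_empty)
qed

text \<open>Multiplying the relation by one monomial with large exponents clears all denominators.
  What results is a polynomial relation with the same coefficients, which algebraic independence
  makes trivial.\<close>

lemma Laurent_monomials_independent:
  fixes x :: "'f::field_char_0 vec" and c :: "int vec \<Rightarrow> int"
  assumes x: "free_generators m x" and A: "finite A" "A \<subseteq> carrier_vec m"
    and sum0: "(\<Sum>e\<in>A. of_int (c e) * monomial x e) = 0" and "e \<in> A"
  shows "c e = 0"
proof -
  have xm: "x \<in> carrier_vec m"
    using x by (simp add: free_generators_def)
  note nz = free_generators_nonzero[OF x]
  \<comment> \<open>In each coordinate the sum of absolute values bounds every exponent in
    \<open>A\<close>, so \<open>e + d\<close> is non-negative for all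
    \<open>e \<in> A\<close>.\<close>
  define d where "d = vec m (\<lambda>i. \<Sum>e\<in>A. \<bar>e $ i\<bar>)"
  have d: "d \<in> carrier_vec m"
    by (simp add: d_def)
  have nonneg: "e $ i + d $ i \<ge> 0" if "e \<in> A" "i < m" for e i
  proof -
    have "\<bar>e $ i\<bar> \<le> (\<Sum>e\<in>A. \<bar>e $ i\<bar>)"
      using A that by (intro member_le_sum) auto
    with that show ?thesis
      by (simp add: d_def)
  qed
  define h :: "int vec \<Rightarrow> nat \<Rightarrow>\<^sub>0 nat"
    where "h e = Abs_poly_mapping (\<lambda>i. if i < m then nat (e $ i + d $ i) else 0)" for e
  have lookup_h: "Poly_Mapping.lookup (h e) i = (if i < m then nat (e $ i + d $ i) else 0)" for e i
  proof -
    have "finite {i. (if i < m then nat (e $ i + d $ i) else 0) \<noteq> 0}"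
      by (rule finite_subset[of _ "{..<m}"]) (auto split: if_splits)
    then show ?thesis
      by (simp add: h_def lookup_Abs_poly_mapping)
  qed
  have inj: "inj_on h A"
  proof (rule inj_onI)
    fix e e' assume e: "e \<in> A" "e' \<in> A" "h e = h e'"
    have "e $ i = e' $ i" if "i < m" for i
    proof -
      have "nat (e $ i + d $ i) = nat (e' $ i + d $ i)"
        using arg_cong[OF e(3), of "\<lambda>p. Poly_Mapping.lookup p i"] that by (simp add: lookup_h)
      then show ?thesis
        using nonneg[OF e(1) that] nonneg[OF e(2) that] by simp
    qed
    moreover have "dim_vec e = m" "dim_vec e' = m"
      using A(2) e by auto
    ultimately show "e = e'"
      by (intro eq_vecI) auto
  qed
  \<comment> \<open>The shift \<open>h\<close> is injective on \<open>A\<close>, so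
    \<open>inv_into\<close> recovers the exponent and no two coefficients are merged.\<close>
  define p :: "(nat \<Rightarrow>\<^sub>0 nat) \<Rightarrow>\<^sub>0 rat" where
    "p = Abs_poly_mapping (\<lambda>v. if v \<in> h ` A then of_int (c (inv_into A h v)) else 0)"
  have "finite {v. (if v \<in> h ` A then rat_of_int (c (inv_into A h v)) else 0) \<noteq> 0}"
    by (rule finite_subset[of _ "h ` A"]) (use A in \<open>auto split: if_splits\<close>)
  then have lookup_p: "Poly_Mapping.lookup p v =
      (if v \<in> h ` A then of_int (c (inv_into A h v)) else 0)" for v
    by (simp add: p_def lookup_Abs_poly_mapping)
  have keys_p: "Poly_Mapping.keys p \<subseteq> h ` A"
    by (auto simp: in_keys_iff lookup_p split: if_splits)
  have "poly_in m p"
    unfolding poly_in_def using keys_p by (force simp: in_keys_iff lookup_h split: if_splits)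
  moreover have "poly_eval of_rat x p = 0"
  proof -
    have "poly_eval of_rat x p = (\<Sum>v\<in>h ` A. of_rat (Poly_Mapping.lookup p v) *
        (\<Prod>i<m. x $ i ^ Poly_Mapping.lookup v i))"
      unfolding poly_eval_def using keys_p A xm
      by (intro sum.mono_neutral_cong_left) (auto simp: in_keys_iff)
    also have "\<dots> = (\<Sum>e\<in>A. of_rat (Poly_Mapping.lookup p (h e)) *
        (\<Prod>i<m. x $ i ^ Poly_Mapping.lookup (h e) i))"
      using inj by (simp add: sum.reindex)
    also have "\<dots> = (\<Sum>e\<in>A. of_int (c e) * monomial x e * monomial x d)"
    proof (rule sum.cong)
      fix e assume e: "e \<in> A"
      have "(\<Prod>i<m. x $ i ^ Poly_Mapping.lookup (h e) i) = monomial x (e + d)"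
        unfolding monomial_def using d nonneg[OF e]
        by (intro prod.cong) (auto simp: lookup_h power_int_nonneg_exp)
      also have "\<dots> = monomial x e * monomial x d"
        using e A d by (intro monomial_add[OF nz]) auto
      finally show "of_rat (Poly_Mapping.lookup p (h e)) *
          (\<Prod>i<m. x $ i ^ Poly_Mapping.lookup (h e) i) = of_int (c e) * monomial x e * monomial x d"
        using e inj by (simp add: lookup_p)
    qed simp
    also have "\<dots> = (\<Sum>e\<in>A. of_int (c e) * monomial x e) * monomial x d"
      by (simp add: sum_distrib_right)
    finally show ?thesis
      using sum0 by simp
  qed
  ultimately have "p = 0"
    using x unfolding free_generators_def by blast
  then have "Poly_Mapping.lookup p (h e) = 0"
    by simp
  then show ?thesis
    using \<open>e \<in> A\<close> inj by (simp add: lookup_p)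
qed

text \<open>The exponent maps \<open>a\<close> and \<open>b\<close> may repeat values, so
  coefficients are compared only after summing over fibres. Grouping both expansions over the finite
  set of occurring exponents reduces the claim to linear independence.\<close>

lemma Laurent_expansion_unique:
  fixes x :: "'f::field_char_0 vec" and c :: "'i \<Rightarrow> int" and d :: "'j \<Rightarrow> int"
  assumes x: "free_generators m x" and fin: "finite I" "finite J"
    and ab: "a ` I \<subseteq> carrier_vec m" "b ` J \<subseteq> carrier_vec m"
    and eq: "(\<Sum>i\<in>I. of_int (c i) * monomial x (a i)) = (\<Sum>j\<in>J. of_int (d j) * monomial x (b j))"
  shows "(\<Sum>i | i \<in> I \<and> a i = e. c i) = (\<Sum>j | j \<in> J \<and> b j = e. d j)"
proof (cases "e \<in> a ` I \<union> b ` J")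
  case True
  define A where "A = a ` I \<union> b ` J"
  have collect: "(\<Sum>i\<in>I. of_int (c i) * monomial x (a i)) =
      (\<Sum>e\<in>A. of_int (\<Sum>i | i \<in> I \<and> a i = e. c i) * monomial x e)"
    if "finite I" "a ` I \<subseteq> A" "finite A" for a :: "'k \<Rightarrow> int vec" and I c A
  proof -
    have "(\<Sum>i\<in>I. of_int (c i) * monomial x (a i)) =
        (\<Sum>e\<in>A. \<Sum>i | i \<in> I \<and> a i = e. of_int (c i) * monomial x (a i))"
      using that by (intro sum.group[symmetric]) auto
    also have "\<dots> = (\<Sum>e\<in>A. of_int (\<Sum>i | i \<in> I \<and> a i = e. c i) * monomial x e)"
      by (intro sum.cong) (auto simp: sum_distrib_right)
    finally show ?thesis .
  qed
  have A: "finite A" "A \<subseteq> carrier_vec m" "e \<in> A"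
    using True fin ab by (auto simp: A_def)
  have "(\<Sum>e\<in>A. of_int ((\<Sum>i | i \<in> I \<and> a i = e. c i) - (\<Sum>j | j \<in> J \<and> b j = e. d j))
      * monomial x e) = 0"
    using eq collect[of I a A c] collect[of J b A d] fin A
    by (simp add: A_def left_diff_distrib sum_subtractf)
  from Laurent_monomials_independent[OF x A(1,2) this A(3)] show ?thesis
    by simp
next
  case False
  then have empty: "{i \<in> I. a i = e} = {}" "{j \<in> J. b j = e} = {}"
    by auto
  show ?thesis
    unfolding empty by simp
qed

section \<open>Tropical degrees of subtraction-free expressions\<close>

text \<open>
  A multiset of exponent vectors stands for the Laurent polynomial that is the sum of the
  corresponding monomials, so that addition and multiplication cause no cancellation.
\<close>

definition monomial_sum :: "'f::field vec \<Rightarrow> int vec multiset \<Rightarrow> 'f"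
  where "monomial_sum y P = (\<Sum>v\<in>#P. monomial y v)"

definition max_weight :: "int vec \<Rightarrow> int vec multiset \<Rightarrow> int"
  where "max_weight r P = Max ((\<lambda>v. v \<bullet> r) ` set_mset P)"

text \<open>Models multiplication: multiplicities are kept, so the monomial sum of the result is the
  product of the monomial sums.\<close>

definition minkowski :: "'a::plus multiset \<Rightarrow> 'a multiset \<Rightarrow> 'a multiset"
  where "minkowski P Q = (\<Sum>v\<in>#P. image_mset ((+) v) Q)"

text \<open>Non-emptiness makes \<open>Max\<close> meaningful in \<open>max_weight\<close> and, in
  the locale below, the monomial sum non-zero.\<close>

definition exponents :: "nat \<Rightarrow> int vec multiset \<Rightarrow> bool"
  where "exponents n P \<longleftrightarrow> P \<noteq> {#} \<and> set_mset P \<subseteq> carrier_vec n"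

text \<open>A relation rather than a function, since a subtraction-free quotient has many
  representations; \<open>tropical_degree_unique\<close> shows that the choice does not matter. The
  number \<open>d\<close> is the value at \<open>r\<close> of the tropicalized quotient.\<close>

definition tropical_degree :: "'f::field vec \<Rightarrow> int vec \<Rightarrow> 'f \<Rightarrow> int \<Rightarrow> bool"
  where "tropical_degree y r f d \<longleftrightarrow> (\<exists>P Q. exponents (dim_vec y) P \<and> exponents (dim_vec y) Q \<and>
    f = monomial_sum y P / monomial_sum y Q \<and> d = max_weight r P - max_weight r Q)"

section \<open>Weights of sums and products of exponent multisets\<close>

lemma sum_mset_count:
  fixes f :: "'a \<Rightarrow> 'b::semiring_1"
  shows "(\<Sum>v\<in>#P. f v) = (\<Sum>v\<in>set_mset P. of_nat (count P v) * f v)"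
proof (induction P)
  case (add a P)
  have "(\<Sum>v\<in>set_mset (add_mset a P). of_nat (count (add_mset a P) v) * f v) =
      (\<Sum>v\<in>insert a (set_mset P). (if v = a then f a else 0) + of_nat (count P v) * f v)"
    by (intro sum.cong) (auto simp: algebra_simps)
  also have "\<dots> = f a + (\<Sum>v\<in>insert a (set_mset P). of_nat (count P v) * f v)"
    by (simp add: sum.distrib)
  also have "(\<Sum>v\<in>insert a (set_mset P). of_nat (count P v) * f v) =
      (\<Sum>v\<in>set_mset P. of_nat (count P v) * f v)"
    by (cases "a \<in># P") (auto simp: insert_absorb not_in_iff)
  finally show ?case
    using add by simp
qed simp

lemma set_mset_minkowski: "set_mset (minkowski P Q) = {v + w |v w. v \<in># P \<and> w \<in># Q}"
  by (auto simp: minkowski_def)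

lemma exponents_minkowski:
  assumes "exponents n P" "exponents n Q"
  shows "exponents n (minkowski P Q)"
proof -
  obtain v where "v \<in># P"
    using assms(1) unfolding exponents_def by (auto elim: multiset_nonemptyE)
  moreover obtain w where "w \<in># Q"
    using assms(2) unfolding exponents_def by (auto elim: multiset_nonemptyE)
  ultimately have "v + w \<in># minkowski P Q"
    by (auto simp: set_mset_minkowski)
  then have "minkowski P Q \<noteq> {#}"
    by auto
  moreover have "v + w \<in> carrier_vec n" if "v \<in># P" "w \<in># Q" for v w
    using assms that by (intro add_carrier_vec) (auto simp: exponents_def)
  ultimately show ?thesis
    by (auto simp: exponents_def set_mset_minkowski)
qed

lemma exponents_add: "exponents n P \<Longrightarrow> exponents n Q \<Longrightarrow> exponents n (P + Q)"
  by (auto simp: exponents_def)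

lemma max_weight_add:
  assumes "exponents n P" "exponents n Q"
  shows "max_weight r (P + Q) = max (max_weight r P) (max_weight r Q)"
  using assms unfolding max_weight_def exponents_def
  by (simp add: image_Un Max_Un)

text \<open>A linear form maps a Minkowski sum to a sumset of integers, whose maximum is reached by
  taking both summands maximal.\<close>

lemma max_weight_minkowski:
  assumes PQ: "exponents n P" "exponents n Q" and r: "r \<in> carrier_vec n"
  shows "max_weight r (minkowski P Q) = max_weight r P + max_weight r Q"
proof -
  let ?w = "\<lambda>v. v \<bullet> r"
  have "?w ` set_mset (minkowski P Q) = {a + b |a b. a \<in> ?w ` set_mset P \<and> b \<in> ?w ` set_mset Q}"
  proof -
    have "?w (a + b) = ?w a + ?w b" if "a \<in># P" "b \<in># Q" for a b
      using PQ that r by (intro add_scalar_prod_distrib[of _ n]) (auto simp: exponents_def)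
    then show ?thesis
      unfolding set_mset_minkowski by (safe; force)
  qed
  moreover have "Max {a + b |a b. a \<in> A \<and> b \<in> B} = Max A + Max B"
    if "finite A" "finite B" "A \<noteq> {}" "B \<noteq> {}" for A B :: "int set"
  proof (rule Max_eqI)
    have "{a + b |a b. a \<in> A \<and> b \<in> B} = (\<lambda>(a, b). a + b) ` (A \<times> B)"
      by auto
    then show "finite {a + b |a b. a \<in> A \<and> b \<in> B}"
      using that by simp
    show "Max A + Max B \<in> {a + b |a b. a \<in> A \<and> b \<in> B}"
      using that Max_in by blast
  qed (use that in \<open>auto intro: add_mono\<close>)
  ultimately show ?thesis
    using PQ by (simp add: max_weight_def exponents_def)
qed

locale subtraction_free =
  fixes y :: "'f::field_char_0 vec" and n :: nat and r :: "int vec"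
  assumes y_carrier: "y \<in> carrier_vec n" and r_carrier: "r \<in> carrier_vec n"
    and y_nonzero: "\<And>i. i < n \<Longrightarrow> y $ i \<noteq> 0"
    and monomial_sum_inject: "\<And>P Q. set_mset P \<subseteq> carrier_vec n \<Longrightarrow> set_mset Q \<subseteq> carrier_vec n \<Longrightarrow>
      monomial_sum y P = monomial_sum y Q \<Longrightarrow> P = Q"
begin

section \<open>Arithmetic of tropical degrees\<close>

lemma monomial_sum_minkowski:
  assumes PQ: "exponents n P" "exponents n Q"
  shows "monomial_sum y (minkowski P Q) = monomial_sum y P * monomial_sum y Q"
proof -
  have "(\<Sum>u\<in>#(\<Sum>v\<in>#P. image_mset ((+) v) Q). monomial y u) =
      (\<Sum>v\<in>#P. \<Sum>w\<in>#Q. monomial y (v + w))"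
    by (induction P) (auto simp: image_mset.compositionality comp_def)
  also have "\<dots> = (\<Sum>v\<in>#P. \<Sum>w\<in>#Q. monomial y v * monomial y w)"
    using PQ by (intro arg_cong[of _ _ sum_mset] image_mset_cong monomial_add[OF y_nonzero])
      (auto simp: exponents_def)
  also have "\<dots> = monomial_sum y P * monomial_sum y Q"
    by (simp only: monomial_sum_def flip: sum_mset_distrib_left sum_mset_distrib_right)
  finally show ?thesis
    by (simp add: monomial_sum_def minkowski_def)
qed

lemma monomial_sum_nonzero:
  assumes "exponents n P"
  shows "monomial_sum y P \<noteq> 0"
  using monomial_sum_inject[of P "{#}"] assms by (auto simp: exponents_def monomial_sum_def)

lemma tropical_degreeE:
  assumes "tropical_degree y r f d"
  obtains P Q where "exponents n P" "exponents n Q" "f = monomial_sum y P / monomial_sum y Q"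
    "d = max_weight r P - max_weight r Q" "monomial_sum y P \<noteq> 0" "monomial_sum y Q \<noteq> 0"
  using assms y_carrier monomial_sum_nonzero unfolding tropical_degree_def by auto

lemma tropical_degreeI:
  assumes "exponents n P" "exponents n Q" "f = monomial_sum y P / monomial_sum y Q"
    "d = max_weight r P - max_weight r Q"
  shows "tropical_degree y r f d"
  using assms y_carrier unfolding tropical_degree_def by auto

text \<open>Cross-multiplying two representations turns equality of quotients into equality of
  exponent multisets. Weights are additive under \<open>minkowski\<close>, so the two differences of
  weights agree.\<close>

lemma tropical_degree_unique:
  assumes "tropical_degree y r f d" "tropical_degree y r f d'"
  shows "d = d'"
proof -
  obtain P Q where PQ: "exponents n P" "exponents n Q" "f = monomial_sum y P / monomial_sum y Q"
      "d = max_weight r P - max_weight r Q" "monomial_sum y P \<noteq> 0" "monomial_sum y Q \<noteq> 0"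
    using assms(1) by (rule tropical_degreeE)
  obtain P' Q' where PQ': "exponents n P'" "exponents n Q'"
      "f = monomial_sum y P' / monomial_sum y Q'"
      "d' = max_weight r P' - max_weight r Q'" "monomial_sum y P' \<noteq> 0" "monomial_sum y Q' \<noteq> 0"
    using assms(2) by (rule tropical_degreeE)
  have "monomial_sum y (minkowski P Q') = monomial_sum y (minkowski P' Q)"
    using PQ PQ' by (simp add: monomial_sum_minkowski frac_eq_eq)
  then have "minkowski P Q' = minkowski P' Q"
    using exponents_minkowski PQ PQ' by (intro monomial_sum_inject) (auto simp: exponents_def)
  then have "max_weight r (minkowski P Q') = max_weight r (minkowski P' Q)"
    by simp
  then show ?thesis
    using PQ PQ' r_carrier by (simp add: max_weight_minkowski)
qed

lemma tropical_degree_mult: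
  assumes "tropical_degree y r f d" "tropical_degree y r f' d'"
  shows "tropical_degree y r (f * f') (d + d')"
proof -
  obtain P Q where PQ: "exponents n P" "exponents n Q" "f = monomial_sum y P / monomial_sum y Q"
      "d = max_weight r P - max_weight r Q"
    using assms(1) by (rule tropical_degreeE)
  obtain P' Q' where PQ': "exponents n P'" "exponents n Q'"
      "f' = monomial_sum y P' / monomial_sum y Q'" "d' = max_weight r P' - max_weight r Q'"
    using assms(2) by (rule tropical_degreeE)
  show ?thesis
    using PQ PQ'
    by (intro tropical_degreeI[OF exponents_minkowski[of n P P'] exponents_minkowski[of n Q Q']])
      (auto simp: monomial_sum_minkowski max_weight_minkowski r_carrier)
qed

text \<open>Over the common denominator \<open>minkowski Q Q'\<close> the numerator is a sum of
  multisets, whose weight is the larger of the two weights.\<close>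

lemma tropical_degree_add:
  assumes "tropical_degree y r f d" "tropical_degree y r f' d'"
  shows "tropical_degree y r (f + f') (max d d')"
proof -
  obtain P Q where PQ: "exponents n P" "exponents n Q" "f = monomial_sum y P / monomial_sum y Q"
      "d = max_weight r P - max_weight r Q" "monomial_sum y P \<noteq> 0" "monomial_sum y Q \<noteq> 0"
    using assms(1) by (rule tropical_degreeE)
  obtain P' Q' where PQ': "exponents n P'" "exponents n Q'"
      "f' = monomial_sum y P' / monomial_sum y Q'"
      "d' = max_weight r P' - max_weight r Q'" "monomial_sum y P' \<noteq> 0" "monomial_sum y Q' \<noteq> 0"
    using assms(2) by (rule tropical_degreeE)
  note exp = exponents_minkowski[OF PQ(1) PQ'(2)] exponents_minkowski[OF PQ'(1) PQ(2)]
  have sum: "monomial_sum y (R + R') = monomial_sum y R + monomial_sum y R'" for R R'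
    by (simp add: monomial_sum_def)
  show ?thesis
  proof (rule tropical_degreeI)
    show "exponents n (minkowski P Q' + minkowski P' Q)" "exponents n (minkowski Q Q')"
      using exp PQ PQ' by (auto intro: exponents_add exponents_minkowski)
    show "f + f' = monomial_sum y (minkowski P Q' + minkowski P' Q) / monomial_sum y (minkowski Q Q')"
      using PQ PQ' by (simp add: sum monomial_sum_minkowski add_frac_eq)
    show "max d d' = max_weight r (minkowski P Q' + minkowski P' Q) - max_weight r (minkowski Q Q')"
      using PQ PQ' by (simp add: max_weight_add[OF exp] max_weight_minkowski r_carrier)
  qed
qed

lemma tropical_degree_inverse:
  assumes "tropical_degree y r f d"
  shows "tropical_degree y r (inverse f) (- d)"
  using assms by (elim tropical_degreeE, intro tropical_degreeI) auto

lemma tropical_degree_monomial: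
  assumes "v \<in> carrier_vec n"
  shows "tropical_degree y r (monomial y v) (v \<bullet> r)"
proof (rule tropical_degreeI)
  \<comment> \<open>The denominator \<open>{#0\<^sub>v n#}\<close> stands for 1 and has weight
    0.\<close>
  show "exponents n {#v#}" "exponents n {#0\<^sub>v n#}"
    using assms by (auto simp: exponents_def)
qed (use r_carrier in \<open>auto simp: monomial_sum_def max_weight_def\<close>)

lemma tropical_degree_one: "tropical_degree y r 1 0"
  using tropical_degree_monomial[of "0\<^sub>v n"] r_carrier by simp

lemma tropical_degree_var:
  assumes "i < n"
  shows "tropical_degree y r (y $ i) (r $ i)"
  using tropical_degree_monomial[of "unit_vec n i"] assms r_carrier
  by (simp add: monomial_unit scalar_prod_left_unit)

lemma tropical_degree_power:
  assumes "tropical_degree y r f d"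
  shows "tropical_degree y r (f ^ k) (int k * d)"
  using assms by (induction k) (auto simp: tropical_degree_one tropical_degree_mult distrib_right)

lemma tropical_degree_powi:
  assumes "tropical_degree y r f d"
  shows "tropical_degree y r (f powi k) (k * d)"
proof (cases "k \<ge> 0")
  case True
  then show ?thesis
    using tropical_degree_power[OF assms, of "nat k"] by (simp add: power_int_def)
next
  case False
  then show ?thesis
    using tropical_degree_inverse[OF tropical_degree_power[OF assms, of "nat (- k)"]]
    by (simp add: power_int_def power_inverse)
qed

lemma tropical_degree_prod:
  assumes "\<And>i. i \<in> I \<Longrightarrow> tropical_degree y r (f i) (d i)"
  shows "tropical_degree y r (\<Prod>i\<in>I. f i) (\<Sum>i\<in>I. d i)"
  using assms
  by (induction I rule: infinite_finite_induct) (auto simp: tropical_degree_one tropical_degree_mult)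

text \<open>A positive integer is a sum of ones, and the maximum of zeros is 0.\<close>

lemma tropical_degree_of_nat:
  "tropical_degree y r (of_nat (Suc k)) 0"
proof (induction k)
  case (Suc k)
  then show ?case
    using tropical_degree_add[OF tropical_degree_one] by force
qed (simp add: tropical_degree_one)

lemma tropical_degree_of_int:
  assumes "c > 0"
  shows "tropical_degree y r (of_int c) 0"
  using tropical_degree_of_nat[of "nat (c - 1)"] assms
  by (metis Suc_as_int Suc_nat_eq_nat_zadd1 diff_add_cancel zle_diff1_eq add.commute of_int_of_nat_eq
      int_nat_eq order_less_imp_le)

lemma tropical_degree_sum:
  assumes "finite I" "I \<noteq> {}" "\<And>i. i \<in> I \<Longrightarrow> tropical_degree y r (f i) (d i)"
  shows "tropical_degree y r (\<Sum>i\<in>I. f i) (Max (d ` I))"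
  using assms
  by (induction I rule: finite_ne_induct) (auto simp: tropical_degree_add)

text \<open>Positive coefficients have degree 0, so only the exponents contribute. The point
  \<open>z\<close> may be any tuple with known degrees, which covers both the \<open>y_hat\<close>
  of a seed and that of its mutation.\<close>

lemma tropical_degree_poly_eval:
  assumes z: "z \<in> carrier_vec n" "\<And>i. i < n \<Longrightarrow> tropical_degree y r (z $ i) (w $ i)"
    and w: "w \<in> carrier_vec n"
    and F: "F \<noteq> 0" "\<And>v. v \<in> Poly_Mapping.keys F \<Longrightarrow> Poly_Mapping.lookup F v > 0"
  shows "tropical_degree y r (poly_eval of_int z F) (trop F w)"
  unfolding poly_eval_def trop_def
proof (rule tropical_degree_sum)
  fix v assume v: "v \<in> Poly_Mapping.keys F"
  have "tropical_degree y r (\<Prod>i<n. z $ i ^ Poly_Mapping.lookup v i)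
      (\<Sum>i<n. int (Poly_Mapping.lookup v i) * w $ i)"
    using z(2) by (intro tropical_degree_prod tropical_degree_power) auto
  from tropical_degree_mult[OF tropical_degree_of_int[OF F(2)[OF v]] this]
  show "tropical_degree y r (of_int (Poly_Mapping.lookup F v) *
      (\<Prod>i<dim_vec z. z $ i ^ Poly_Mapping.lookup v i))
      (\<Sum>k<dim_vec w. int (Poly_Mapping.lookup v k) * w $ k)"
    using z(1) w by simp
qed (use F in auto)

end

section \<open>Pointed elements of a full rank seed\<close>

lemma skew_symmetrizer_entry:
  assumes "skew_symmetrizer S (exchange_matrix s)"
    and "i < dim_col (ext_matrix s)" "j < dim_col (ext_matrix s)"
  shows "S $$ (j, j) * ext_matrix s $$ (j, i) = - (S $$ (i, i) * ext_matrix s $$ (i, j))"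
proof -
  let ?n = "dim_col (ext_matrix s)"
  have S: "S \<in> carrier_mat ?n ?n" "diagonal_mat S"
      and skew: "transpose_mat (S * exchange_matrix s) = - (S * exchange_matrix s)"
    using assms(1) by (auto simp: skew_symmetrizer_def exchange_matrix_def)
  have entry: "(S * exchange_matrix s) $$ (i, j) = S $$ (i, i) * ext_matrix s $$ (i, j)"
    if "i < ?n" "j < ?n" for i j
  proof -
    have "(S * exchange_matrix s) $$ (i, j) = (\<Sum>l<?n. S $$ (i, l) * ext_matrix s $$ (l, j))"
      using S(1) that by (auto simp: scalar_prod_def exchange_matrix_def atLeast0LessThan)
    also have "\<dots> = (\<Sum>l<?n. if l = i then S $$ (i, i) * ext_matrix s $$ (i, j) else 0)"
      using S that by (intro sum.cong) (auto simp: diagonal_mat_def)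
    finally show ?thesis
      using that by simp
  qed
  have "(S * exchange_matrix s) $$ (j, i) = - (S * exchange_matrix s) $$ (i, j)"
    using arg_cong[OF skew, of "\<lambda>M. M $$ (i, j)"] assms S(1) by (simp add: exchange_matrix_def)
  then show ?thesis
    using assms by (simp add: entry)
qed

lemma is_seed_diagonal:
  assumes "is_seed m n s" "k < n"
  shows "ext_matrix s $$ (k, k) = 0"
proof -
  obtain S where S: "skew_symmetrizer S (exchange_matrix s)"
    using assms(1) by (auto simp: is_seed_def)
  have n: "dim_col (ext_matrix s) = n"
    using assms(1) by (auto simp: is_seed_def)
  from skew_symmetrizer_entry[OF S] n assms(2)
  have "S $$ (k, k) * ext_matrix s $$ (k, k) = - (S $$ (k, k) * ext_matrix s $$ (k, k))"
    by blast
  moreover have "S $$ (k, k) > 0"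
    using S n assms(2) by (simp add: skew_symmetrizer_def exchange_matrix_def)
  ultimately show ?thesis
    by simp
qed

section \<open>Exponents of polynomials in the \<open>y_hat\<close> variables\<close>

definition exponent_vec :: "nat \<Rightarrow> (nat \<Rightarrow>\<^sub>0 nat) \<Rightarrow> int vec"
  where "exponent_vec n v = vec n (\<lambda>i. int (Poly_Mapping.lookup v i))"

lemma exponent_vec_carrier [simp]: "exponent_vec n v \<in> carrier_vec n"
  by (simp add: exponent_vec_def)

lemma exponent_vec_0 [simp]: "exponent_vec n 0 = 0\<^sub>v n"
  by (auto simp: exponent_vec_def)

lemma exponent_vec_inject:
  assumes "Poly_Mapping.keys v \<subseteq> {..<n}" "Poly_Mapping.keys w \<subseteq> {..<n}"
    and "exponent_vec n v = exponent_vec n w"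
  shows "v = w"
proof (rule poly_mapping_eqI)
  fix i
  show "Poly_Mapping.lookup v i = Poly_Mapping.lookup w i"
  proof (cases "i < n")
    case True
    then show ?thesis
      using arg_cong[OF assms(3), of "\<lambda>u. u $ i"] by (simp add: exponent_vec_def)
  next
    case False
    then have "i \<notin> Poly_Mapping.keys v" "i \<notin> Poly_Mapping.keys w"
      using assms by auto
    then show ?thesis
      by (simp add: in_keys_iff)
  qed
qed

text \<open>Full rank is expressed as a trivial kernel over the integers. This is the form in which
  it acts: distinct exponents in \<open>y_hat\<close> give distinct exponents in the
  cluster.\<close>

locale full_rank_seed =
  fixes m n :: nat and s :: "'f::field_char_0 seed"
  assumes seed: "is_seed m n s" and kernel: "mat_kernel (ext_matrix s) = {0\<^sub>v n}"
begin

lemma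
  shows free_cluster: "free_generators m (cluster s)"
    and matrix_carrier: "ext_matrix s \<in> carrier_mat m n"
    and matrix_dims [simp]: "dim_row (ext_matrix s) = m" "dim_col (ext_matrix s) = n"
    and dim_cluster [simp]: "dim_vec (cluster s) = m"
    and y_hat_carrier: "y_hat s \<in> carrier_vec n"
  using seed by (auto simp: is_seed_def free_generators_def y_hat_def)

lemmas cluster_nonzero = free_generators_nonzero[OF free_cluster]

lemma mult_matrix_carrier [simp]: "ext_matrix s *\<^sub>v v \<in> carrier_vec m"
  by (metis carrier_vecI dim_mult_mat_vec matrix_dims(1))

lemma mult_matrix_inject:
  assumes "v \<in> carrier_vec n" "w \<in> carrier_vec n" "ext_matrix s *\<^sub>v v = ext_matrix s *\<^sub>v w"
  shows "v = w"
proof -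
  have "ext_matrix s *\<^sub>v (v - w) = 0\<^sub>v m"
    using assms matrix_carrier by (simp add: mult_minus_distrib_mat_vec)
  then have "v - w \<in> mat_kernel (ext_matrix s)"
    using assms matrix_carrier by (intro mat_kernelI[of _ m n]) auto
  then have "v - w = 0\<^sub>v n"
    using kernel by simp
  then have "(v - w) $ i = 0" if "i < n" for i
    using that by simp
  then have "v $ i = w $ i" if "i < n" for i
    using that assms(1,2) by force
  then show ?thesis
    using assms by (intro eq_vecI) auto
qed

lemma mult_matrix_zero [simp]: "ext_matrix s *\<^sub>v 0\<^sub>v n = 0\<^sub>v m"
  by (intro eq_vecI) (auto simp: scalar_prod_def)

lemma shifted_exponent_inject:
  assumes "g \<in> carrier_vec m" "Poly_Mapping.keys v \<subseteq> {..<n}" "Poly_Mapping.keys w \<subseteq> {..<n}"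
    and eq: "g + ext_matrix s *\<^sub>v exponent_vec n v = g + ext_matrix s *\<^sub>v exponent_vec n w"
  shows "v = w"
proof -
  have "(ext_matrix s *\<^sub>v exponent_vec n v) $ i = (ext_matrix s *\<^sub>v exponent_vec n w) $ i"
    if "i < m" for i
    using arg_cong[OF eq, of "\<lambda>u. u $ i"] that assms(1) by (simp del: index_mult_mat_vec)
  then have "ext_matrix s *\<^sub>v exponent_vec n v = ext_matrix s *\<^sub>v exponent_vec n w"
    by (intro eq_vecI) (auto simp del: index_mult_mat_vec)
  then show ?thesis
    using assms(2,3) by (metis exponent_vec_inject exponent_vec_carrier mult_matrix_inject)
qed

lemma monomial_y_hat:
  assumes "v \<in> carrier_vec n"
  shows "monomial (y_hat s) v = monomial (cluster s) (ext_matrix s *\<^sub>v v)"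
  unfolding y_hat_def matrix_dims
  using monomial_mult_mat_vec[OF cluster_nonzero matrix_carrier assms] by simp

lemma y_hat_nonzero:
  assumes "k < n"
  shows "y_hat s $ k \<noteq> 0"
  using monomial_nonzero[OF cluster_nonzero, where g = "col (ext_matrix s) k"] assms
  by (simp add: y_hat_def carrier_vecI)

lemma Laurent_expansion_pointed:
  assumes "g \<in> carrier_vec m"
  shows "monomial (cluster s) g * poly_eval of_int (y_hat s) F =
    (\<Sum>v\<in>Poly_Mapping.keys F. of_int (Poly_Mapping.lookup F v) *
      monomial (cluster s) (g + ext_matrix s *\<^sub>v exponent_vec n v))"
proof -
  have "(\<Prod>i<dim_vec (y_hat s). y_hat s $ i ^ Poly_Mapping.lookup v i) =
      monomial (cluster s) (ext_matrix s *\<^sub>v exponent_vec n v)" for v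
  proof -
    have "(\<Prod>i<dim_vec (y_hat s). y_hat s $ i ^ Poly_Mapping.lookup v i) =
        monomial (y_hat s) (exponent_vec n v)"
      using y_hat_carrier by (auto simp: monomial_def exponent_vec_def)
    then show ?thesis
      by (simp add: monomial_y_hat)
  qed
  then show ?thesis
    unfolding poly_eval_def using assms
    by (simp add: sum_distrib_left monomial_add[OF cluster_nonzero] mult_ac)
qed

text \<open>By full rank each exponent \<open>g + ext_matrix s *\<^sub>v exponent_vec n v\<close>
  comes from one \<open>v\<close> only, so a coefficient of \<open>F\<close> can be read off from
  any Laurent expansion of \<open>u\<close>.\<close>

lemma pointed_coefficient:
  fixes d :: "'j \<Rightarrow> int"
  assumes u: "pointed_with s u g F" and J: "finite J" "b ` J \<subseteq> carrier_vec m"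
    and eq: "u = (\<Sum>j\<in>J. of_int (d j) * monomial (cluster s) (b j))"
    and v: "Poly_Mapping.keys v \<subseteq> {..<n}"
  shows "Poly_Mapping.lookup F v =
    (\<Sum>j | j \<in> J \<and> b j = g + ext_matrix s *\<^sub>v exponent_vec n v. d j)"
proof -
  let ?a = "\<lambda>v. g + ext_matrix s *\<^sub>v exponent_vec n v"
  have g: "g \<in> carrier_vec m" and F: "poly_in n F"
      and u: "u = monomial (cluster s) g * poly_eval of_int (y_hat s) F"
    using u by (auto simp: pointed_with_def)
  have "{w \<in> Poly_Mapping.keys F. ?a w = ?a v} = Poly_Mapping.keys F \<inter> {v}"
    using shifted_exponent_inject[OF g _ v] F by (auto simp: poly_in_def)
  moreover have "(\<Sum>w | w \<in> Poly_Mapping.keys F \<and> ?a w = ?a v. Poly_Mapping.lookup F w) =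
      (\<Sum>j | j \<in> J \<and> b j = ?a v. d j)"
    using u eq g J
    by (intro Laurent_expansion_unique[OF free_cluster])
      (auto simp: Laurent_expansion_pointed simp del: of_int_sum intro!: add_carrier_vec)
  ultimately show ?thesis
    by (simp add: in_keys_iff Int_insert_right split: if_splits)
qed

text \<open>The constant term 1 places \<open>g\<close> among the exponents of the second expansion
  and \<open>g'\<close> among those of the first. Each is the other plus the matrix applied to a
  non-negative vector, and the sum of these two vectors lies in the kernel.\<close>

lemma pointed_with_unique:
  assumes gF: "pointed_with s u g F" and gF': "pointed_with s u g' F'"
  shows "g = g' \<and> F = F'"
proof -
  let ?a = "\<lambda>g v. g + ext_matrix s *\<^sub>v exponent_vec n v"
  have expand: "Poly_Mapping.lookup F v = (\<Sum>w | w \<in> Poly_Mapping.keys F' \<and> ?a g' w = ?a g v. Poly_Mapping.lookup F' w)"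
    if "pointed_with s u g F" "pointed_with s u g' F'" "Poly_Mapping.keys v \<subseteq> {..<n}" for g g' F F' v
    using that(2)
    by (intro pointed_coefficient[OF that(1)] that(3))
      (auto simp: pointed_with_def Laurent_expansion_pointed intro!: add_carrier_vec)
  have lead: "\<exists>w. g = ?a g' w" if "pointed_with s u g F" "pointed_with s u g' F'" for g g' F F'
  proof -
    have "g \<in> carrier_vec m" "Poly_Mapping.lookup F 0 = 1"
      using that by (auto simp: pointed_with_def)
    then have "(\<Sum>w | w \<in> Poly_Mapping.keys F' \<and> ?a g' w = g. Poly_Mapping.lookup F' w) = 1"
      using expand[OF that, of 0] by simp
    then have "{w \<in> Poly_Mapping.keys F'. ?a g' w = g} \<noteq> {}"
      by (intro notI) (simp only: sum.empty)
    then show ?thesis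
      by blast
  qed
  have g: "g \<in> carrier_vec m" "g' \<in> carrier_vec m"
    using gF gF' by (auto simp: pointed_with_def)
  obtain v w where vw: "g = ?a g' v" "g' = ?a g w"
    using lead gF gF' by meson
  have "ext_matrix s *\<^sub>v (exponent_vec n v + exponent_vec n w) = 0\<^sub>v m"
  proof -
    let ?v = "ext_matrix s *\<^sub>v exponent_vec n v" and ?w = "ext_matrix s *\<^sub>v exponent_vec n w"
    have "?v $ i + ?w $ i = 0" if "i < m" for i
      using arg_cong[OF vw(1), of "\<lambda>u. u $ i"] arg_cong[OF vw(2), of "\<lambda>u. u $ i"] that g
      by (simp del: index_mult_mat_vec)
    then have "?v + ?w = 0\<^sub>v m"
      by (intro eq_vecI) (auto simp del: index_mult_mat_vec)
    then show ?thesis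
      using matrix_carrier by (simp add: mult_add_distrib_mat_vec)
  qed
  then have "exponent_vec n v + exponent_vec n w = 0\<^sub>v n"
    using kernel matrix_carrier mat_kernelI[of "ext_matrix s" m n] by auto
  \<comment> \<open>Both summands have non-negative entries, so a zero sum forces both to
    vanish.\<close>
  then have "exponent_vec n v = 0\<^sub>v n"
    by (auto simp: vec_eq_iff exponent_vec_def)
  then have eq: "g = g'"
    using vw(1) g matrix_carrier by simp
  have "Poly_Mapping.lookup F v = Poly_Mapping.lookup F' v" for v
  proof (cases "Poly_Mapping.keys v \<subseteq> {..<n}")
    case True
    have "{w \<in> Poly_Mapping.keys F. ?a g w = ?a g v} = {w \<in> Poly_Mapping.keys F. w = v}"
      using shifted_exponent_inject[OF g(1) _ True] gF by (auto simp: pointed_with_def poly_in_def)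
    \<comment> \<open>With \<open>g = g'\<close> both coefficients equal the same fibre sum over
      \<open>F'\<close>.\<close>
    then show ?thesis
      using expand[OF gF gF' True] expand[OF gF' gF' True] eq by simp
  next
    case False
    then have "v \<notin> Poly_Mapping.keys F" "v \<notin> Poly_Mapping.keys F'"
      using gF gF' unfolding pointed_with_def poly_in_def by auto
    then show ?thesis
      by (simp add: in_keys_iff)
  qed
  then show ?thesis
    using eq by (auto intro: poly_mapping_eqI)
qed

lemma pointed_with_iff:
  assumes "pointed_with s u g F"
  shows "ext_g_vector s u = g" "F_polynomial s u = F"
  using assms pointed_with_unique unfolding ext_g_vector_def F_polynomial_def
  by (blast intro!: the_equality)+

text \<open>Each coefficient of \<open>F\<close> is a sum of coefficients of a non-negative
  expansion. Several keys of \<open>P\<close> may share one vector, since they can differ at indices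
  from \<open>m\<close> on.\<close>

lemma positive_Laurent_F_polynomial:
  assumes u: "pointed_with s u g F" "positive_Laurent (cluster s) u"
    and v: "v \<in> Poly_Mapping.keys F"
  shows "Poly_Mapping.lookup F v > 0"
proof -
  obtain P :: "(nat \<Rightarrow>\<^sub>0 int) \<Rightarrow>\<^sub>0 nat" where P: "u = (\<Sum>e \<in> Poly_Mapping.keys P.
      of_nat (Poly_Mapping.lookup P e) * (\<Prod>i<dim_vec (cluster s). cluster s $ i powi Poly_Mapping.lookup e i))"
    using u(2) unfolding positive_Laurent_def by blast
  have "Poly_Mapping.keys v \<subseteq> {..<n}"
    using u(1) v by (auto simp: pointed_with_def poly_in_def)
  moreover have "u = (\<Sum>e\<in>Poly_Mapping.keys P. of_int (int (Poly_Mapping.lookup P e)) *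
      monomial (cluster s) (vec m (Poly_Mapping.lookup e)))"
    unfolding P by (auto simp: monomial_def)
  ultimately have "Poly_Mapping.lookup F v = (\<Sum>e | e \<in> Poly_Mapping.keys P \<and>
      vec m (Poly_Mapping.lookup e) = g + ext_matrix s *\<^sub>v exponent_vec n v. int (Poly_Mapping.lookup P e))"
    by (intro pointed_coefficient[OF u(1)]) auto
  then have "Poly_Mapping.lookup F v \<ge> 0"
    by (simp add: sum_nonneg)
  moreover have "Poly_Mapping.lookup F v \<noteq> 0"
    using v by (simp add: in_keys_iff)
  ultimately show ?thesis
    by simp
qed

lemma monomial_sum_y_hat:
  assumes "set_mset P \<subseteq> carrier_vec n"
  shows "monomial_sum (y_hat s) P =
    (\<Sum>v\<in>set_mset P. of_int (int (count P v)) * monomial (cluster s) (ext_matrix s *\<^sub>v v))"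
proof -
  have "monomial_sum (y_hat s) P = (\<Sum>v\<in>set_mset P. of_nat (count P v) * monomial (y_hat s) v)"
    by (simp add: monomial_sum_def sum_mset_count)
  also have "\<dots> = (\<Sum>v\<in>set_mset P. of_nat (count P v) * monomial (cluster s) (ext_matrix s *\<^sub>v v))"
    using assms by (intro sum.cong) (auto simp: monomial_y_hat)
  finally show ?thesis
    by simp
qed

text \<open>A monomial sum in \<open>y_hat\<close> is a Laurent expansion in the cluster with
  multiplicities as coefficients. Full rank keeps distinct exponents apart, so uniqueness of the
  expansion recovers every multiplicity.\<close>

lemma subtraction_free_y_hat:
  assumes "r \<in> carrier_vec n"
  shows "subtraction_free (y_hat s) n r"
proof
  fix P Q :: "int vec multiset"
  assume PQ: "set_mset P \<subseteq> carrier_vec n" "set_mset Q \<subseteq> carrier_vec n"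
    and eq: "monomial_sum (y_hat s) P = monomial_sum (y_hat s) Q"
  show "P = Q"
  proof (rule multiset_eqI)
    fix v
    let ?B = "\<lambda>v. ext_matrix s *\<^sub>v v"
    have fibre: "(\<Sum>w | w \<in># R \<and> ?B w = ?B v. int (count R w)) = int (count R v)"
      if R: "set_mset R \<subseteq> carrier_vec n" and v: "v \<in> carrier_vec n" for R
    proof -
      have "{w. w \<in># R \<and> ?B w = ?B v} = set_mset R \<inter> {v}"
        using R mult_matrix_inject[OF _ v] by blast
      then show ?thesis
        by (auto simp: Int_insert_right count_eq_zero_iff)
    qed
    show "count P v = count Q v"
    proof (cases "v \<in> carrier_vec n")
      case True
      have "(\<Sum>w | w \<in># P \<and> ?B w = ?B v. int (count P w)) =
          (\<Sum>w | w \<in># Q \<and> ?B w = ?B v. int (count Q w))"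
        using eq PQ by (intro Laurent_expansion_unique[OF free_cluster])
          (auto simp: monomial_sum_y_hat simp del: of_int_of_nat_eq)
      then show ?thesis
        using fibre[OF PQ(1) True] fibre[OF PQ(2) True] by simp
    next
      case False
      then have "v \<notin># P" "v \<notin># Q"
        using PQ by auto
      then show ?thesis
        by (simp add: not_in_iff)
    qed
  qed
qed (use assms y_hat_carrier y_hat_nonzero in auto)

end

section \<open>Mutation\<close>

lemma pos_minus: "pos (- a) = pos a - a"
  by (simp add: max_def)

text \<open>With \<open>a\<close> = b_ik and \<open>b\<close> = b_kj this is the correction term of
  the g-vector rule, b_kj taking the place of g_k. So for \<open>j \<noteq> k\<close> column
  \<open>j\<close> mutates as an extended g-vector does.\<close>

lemma mutation_coefficient: "pos a * pos b - pos (- a) * pos (- b) = a * pos b + pos (- a) * b"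
  unfolding pos_minus by (simp add: algebra_simps)

lemma ext_matrix_mutate:
  assumes "ext_matrix s \<in> carrier_mat m n" "i < m" "j < n"
  shows "ext_matrix (mutate k s) $$ (i, j) = (if i = k \<or> j = k then - ext_matrix s $$ (i, j)
    else ext_matrix s $$ (i, j) + ext_matrix s $$ (i, k) * pos (ext_matrix s $$ (k, j))
      + pos (- ext_matrix s $$ (i, k)) * ext_matrix s $$ (k, j))"
  using assms mutation_coefficient[of "ext_matrix s $$ (i, k)" "ext_matrix s $$ (k, j)"]
  by (auto simp: mutate_def Let_def)

lemma ext_matrix_mutate_carrier:
  assumes "ext_matrix s \<in> carrier_mat m n"
  shows "ext_matrix (mutate k s) \<in> carrier_mat m n"
  using assms by (auto simp: mutate_def Let_def)

section \<open>Mutation preserves full rank\<close>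

lemma mult_mat_vec_entry:
  assumes "A \<in> carrier_mat m n" "v \<in> carrier_vec n" "i < m"
  shows "(A *\<^sub>v v) $ i = (\<Sum>j<n. A $$ (i, j) * v $ j)"
  using assms by (auto simp: scalar_prod_def atLeast0LessThan)

text \<open>A kernel vector \<open>v\<close> of the mutated matrix is turned into a kernel vector
  \<open>w\<close> of the original by altering coordinate \<open>k\<close> alone. As
  \<open>w\<close> vanishes, \<open>v\<close> can be non-zero only at \<open>k\<close>, and the
  amount of the alteration excludes that too.\<close>

lemma mat_kernel_mutate:
  assumes seed: "is_seed m n s" and "n \<le> m" "k < n"
    and kernel: "mat_kernel (ext_matrix s) = {0\<^sub>v n}"
  shows "mat_kernel (ext_matrix (mutate k s)) = {0\<^sub>v n}"
proof -
  define B where "B = ext_matrix s"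
  define B' where "B' = ext_matrix (mutate k s)"
  have B: "B \<in> carrier_mat m n"
    using seed by (simp add: B_def is_seed_def)
  have B': "B' \<in> carrier_mat m n"
    using B by (simp add: B'_def B_def ext_matrix_mutate_carrier)
  have B_kk: "B $$ (k, k) = 0"
    using is_seed_diagonal[OF seed] assms(3) by (simp add: B_def)
  have entry: "B' $$ (i, j) = (if i = k \<or> j = k then - B $$ (i, j)
      else B $$ (i, j) + B $$ (i, k) * pos (B $$ (k, j)) + pos (- B $$ (i, k)) * B $$ (k, j))"
    if "i < m" "j < n" for i j
    using ext_matrix_mutate[OF B[unfolded B_def] that] by (simp add: B_def B'_def)
  have "v = 0\<^sub>v n" if "v \<in> mat_kernel B'" for v
  proof -
    from mat_kernelD[OF B' that] have v: "v \<in> carrier_vec n" and Bv: "B' *\<^sub>v v = 0\<^sub>v m"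
      by auto
    have row: "(\<Sum>j<n. B' $$ (i, j) * v $ j) = 0" if "i < m" for i
      using mult_mat_vec_entry[OF B' v that] Bv that by simp
    have row_k: "(\<Sum>j<n. B $$ (k, j) * v $ j) = 0"
      using row[of k] assms(2,3) by (simp add: entry sum_negf)
    \<comment> \<open>Since row \<open>k\<close> of \<open>B\<close> annihilates \<open>v\<close>, row \<open>i\<close> of \<open>B'\<close> at \<open>v\<close> is row \<open>i\<close> of \<open>B\<close> at \<open>w\<close>.\<close>
    define c where "c = (\<Sum>j<n. pos (B $$ (k, j)) * v $ j) - 2 * v $ k"
    define w where "w = vec n (\<lambda>j. v $ j + (if j = k then c else 0))"
    have "(\<Sum>j<n. B $$ (i, j) * w $ j) = 0" if i: "i < m" for i
    proof -
      have sum_w: "(\<Sum>j<n. B $$ (i, j) * w $ j) = (\<Sum>j<n. B $$ (i, j) * v $ j) + B $$ (i, k) * c"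
      proof -
        have "(\<Sum>j<n. B $$ (i, j) * w $ j) =
            (\<Sum>j<n. B $$ (i, j) * v $ j + (if j = k then B $$ (i, k) * c else 0))"
          by (intro sum.cong) (auto simp: w_def algebra_simps)
        then show ?thesis
          using assms(3) by (simp add: sum.distrib)
      qed
      show ?thesis
      proof (cases "i = k")
        case True
        then show ?thesis
          unfolding sum_w using row_k B_kk by simp
      next
        case False
        \<comment> \<open>At \<open>j = k\<close> the general formula would give b_ik, because b_kk
          = 0; the last term corrects this to - b_ik.\<close>
        have "(\<Sum>j<n. B' $$ (i, j) * v $ j) = (\<Sum>j<n. B $$ (i, j) * v $ j
            + B $$ (i, k) * (pos (B $$ (k, j)) * v $ j) + pos (- B $$ (i, k)) * (B $$ (k, j) * v $ j)
            - (if j = k then 2 * B $$ (i, k) * v $ k else 0))"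
          using i False B_kk by (intro sum.cong) (auto simp: entry algebra_simps)
        also have "\<dots> = (\<Sum>j<n. B $$ (i, j) * v $ j)
            + B $$ (i, k) * (\<Sum>j<n. pos (B $$ (k, j)) * v $ j)
            + pos (- B $$ (i, k)) * (\<Sum>j<n. B $$ (k, j) * v $ j) - 2 * B $$ (i, k) * v $ k"
          using assms(3) by (simp add: sum.distrib sum_subtractf sum_distrib_left)
        finally show ?thesis
          unfolding sum_w c_def using row[OF i] row_k by (simp add: algebra_simps)
      qed
    qed
    then have "B *\<^sub>v w = 0\<^sub>v m"
      using B mult_mat_vec_entry[OF B, of w]
      by (intro eq_vecI) (auto simp: w_def simp del: index_mult_mat_vec)
    then have "w \<in> mat_kernel B"
      using B by (intro mat_kernelI[of _ m n]) (auto simp: w_def)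
    then have w0: "w = 0\<^sub>v n"
      using kernel by (simp add: B_def)
    have v_j: "v $ j = 0" if "j < n" "j \<noteq> k" for j
      using arg_cong[OF w0, of "\<lambda>u. u $ j"] that by (simp add: w_def)
    \<comment> \<open>Only \<open>j = k\<close> could contribute, and there b_kk = 0. Hence
      \<open>c = - 2 * v $ k\<close>, and \<open>v $ k + c = 0\<close> reads
      \<open>- v $ k = 0\<close>.\<close>
    have "(\<Sum>j<n. pos (B $$ (k, j)) * v $ j) = 0"
      using v_j B_kk by (intro sum.neutral) (metis lessThan_iff max.idem mult_eq_0_iff)
    moreover have "v $ k + c = 0"
      using arg_cong[OF w0, of "\<lambda>u. u $ k"] assms(3) by (simp add: w_def)
    ultimately have "v $ k = 0"
      by (simp add: c_def)
    with v_j show ?thesis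
      using v by (intro eq_vecI) auto
  qed
  moreover have "0\<^sub>v n \<in> mat_kernel B'"
    using B' by (intro mat_kernelI[of _ m n] eq_vecI) (auto simp: scalar_prod_def)
  ultimately show ?thesis
    unfolding B'_def by blast
qed

text \<open>The set of columns hides repetitions, so distinctness comes first: by the rank, a
  maximal independent set of columns already has \<open>n\<close> elements. After that, a non-zero
  integer kernel vector is a rational linear dependence among the columns.\<close>

lemma full_rank_mat_kernel:
  assumes A: "A \<in> carrier_mat m n"
    and rank: "vec_space.rank m (map_mat rat_of_int A) = n"
  shows "mat_kernel A = {0\<^sub>v n}"
proof -
  interpret vec_space "TYPE(rat)" m .
  let ?A = "map_mat rat_of_int A"
  have cA: "?A \<in> carrier_mat m n"
    using A by simp
  have "\<exists>U. maximal U (\<lambda>T. T \<subseteq> set (cols ?A) \<and> lin_indpt T)"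
    using maximal_exists_superset[of "set (cols ?A)" "\<lambda>T. T \<subseteq> set (cols ?A) \<and> lin_indpt T" "{}"]
    by (auto simp: lin_dep_def)
  then obtain U where U: "maximal U (\<lambda>T. T \<subseteq> set (cols ?A) \<and> lin_indpt T)"
    by blast
  have "n = card U"
    using rank_card_indpt[OF cA U] rank by simp
  also have "\<dots> \<le> card (set (cols ?A))"
    using U by (intro card_mono) (auto simp: maximal_def)
  finally have "card (set (cols ?A)) = length (cols ?A)"
    using card_length[of "cols ?A"] cA by simp
  then have distinct: "distinct (cols ?A)"
    by (rule card_distinct)
  have "v = 0\<^sub>v n" if "v \<in> mat_kernel A" for v
  proof (rule ccontr)
    assume "v \<noteq> 0\<^sub>v n"
    from mat_kernelD[OF A that] have v: "v \<in> carrier_vec n" and Av: "A *\<^sub>v v = 0\<^sub>v m"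
      by auto
    have "map_vec rat_of_int v \<noteq> 0\<^sub>v n"
      using v \<open>v \<noteq> 0\<^sub>v n\<close> by (auto simp: vec_eq_iff)
    moreover have "?A *\<^sub>v map_vec rat_of_int v = 0\<^sub>v m"
      using of_int_hom.mult_mat_vec_hom[OF A v, where ?'a = rat] Av by (auto simp: vec_eq_iff)
    ultimately have "lin_dep (set (cols ?A))"
      using v by (intro lin_depI[OF cA _ _ _ distinct]) auto
    then show False
      using full_rank_lin_indpt[OF cA rank distinct] by simp
  qed
  moreover have "0\<^sub>v n \<in> mat_kernel A"
    using A by (intro mat_kernelI[of _ m n] eq_vecI) (auto simp: scalar_prod_def)
  ultimately show ?thesis
    by blast
qed

section \<open>Clusters and \<open>y_hat\<close> variables across one mutation\<close>

definition compatible_g_vectors :: "nat \<Rightarrow> int mat \<Rightarrow> int vec \<Rightarrow> int vec \<Rightarrow> bool"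
  where "compatible_g_vectors k B g g' \<longleftrightarrow> g' $ k = - g $ k \<and>
    (\<forall>i<dim_row B. i \<noteq> k \<longrightarrow>
      g' $ i = g $ i + pos (- B $$ (i, k)) * g $ k + B $$ (i, k) * pos (g $ k))"

text \<open>That the mutated seed is again a seed is assumed, since a cluster pattern provides it at
  every vertex; its kernel condition is derived below.\<close>

locale full_rank_mutation = full_rank_seed m n s
  for m n and s :: "'f::field_char_0 seed" +
  fixes k :: nat
  assumes k: "k < n" and n_le_m: "n \<le> m" and seed': "is_seed m n (mutate k s)"
begin

sublocale mutated: full_rank_seed m n "mutate k s"
  using seed' mat_kernel_mutate[OF seed n_le_m k kernel] by unfold_locales

abbreviation b :: "nat \<Rightarrow> nat \<Rightarrow> int"
  where "b i j \<equiv> ext_matrix s $$ (i, j)"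

lemma k_less: "k < m"
  using k n_le_m by simp

lemma b_diagonal: "b k k = 0"
  using is_seed_diagonal[OF seed k] .

lemmas mutated_entry = ext_matrix_mutate[OF matrix_carrier, where k = k]

lemma col_entry: "i < m \<Longrightarrow> j < n \<Longrightarrow> col (ext_matrix s) j $ i = b i j"
  by simp

lemma y_hat_as_monomial:
  assumes "j < n"
  shows "y_hat s $ j = monomial (cluster s) (col (ext_matrix s) j)"
  using assms by (simp add: y_hat_def)

text \<open>As \<open>pos a = pos (- a) + a\<close>, the two products of the exchange relation
  differ by the factor \<open>y_hat s $ k\<close>. Factoring out the smaller one isolates
  \<open>1 + y_hat s $ k\<close>.\<close>

lemma mutated_cluster:
  "i < m \<Longrightarrow> i \<noteq> k \<Longrightarrow> cluster (mutate k s) $ i = cluster s $ i"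
  "cluster (mutate k s) $ k = inverse (cluster s $ k) *
    monomial (cluster s) (vec m (\<lambda>i. pos (- b i k))) * (1 + y_hat s $ k)"
proof -
  have "vec m (\<lambda>i. pos (b i k)) = vec m (\<lambda>i. pos (- b i k)) + col (ext_matrix s) k"
    using k by (auto simp: pos_minus)
  then have "monomial (cluster s) (vec m (\<lambda>i. pos (b i k))) =
      monomial (cluster s) (vec m (\<lambda>i. pos (- b i k))) * y_hat s $ k"
    using k by (simp add: monomial_add[OF cluster_nonzero] y_hat_as_monomial carrier_vecI)
  moreover have "cluster (mutate k s) $ k = inverse (cluster s $ k) *
      (monomial (cluster s) (vec m (\<lambda>i. pos (b i k))) + monomial (cluster s) (vec m (\<lambda>i. pos (- b i k))))"
    using k_less by (simp add: mutate_def Let_def monomial_def)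
  ultimately show "cluster (mutate k s) $ k = inverse (cluster s $ k) *
      monomial (cluster s) (vec m (\<lambda>i. pos (- b i k))) * (1 + y_hat s $ k)"
    by (simp add: algebra_simps)
qed (simp add: mutate_def Let_def)

text \<open>Only variable \<open>k\<close> changes. Its power adds
  \<open>pos (- b i k) * g' $ k\<close> to the other exponents and leaves a power of
  \<open>1 + y_hat s $ k\<close>. The relation between \<open>g\<close> and \<open>g'\<close> is
  linear; applications absorb their piecewise linear terms into \<open>g\<close>.\<close>

lemma monomial_mutated:
  assumes g: "g \<in> carrier_vec m" and g': "g' \<in> carrier_vec m"
    and g_k: "g $ k = - g' $ k"
    and g_i: "\<And>i. i < m \<Longrightarrow> i \<noteq> k \<Longrightarrow> g $ i = g' $ i + pos (- b i k) * g' $ k"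
  shows "monomial (cluster (mutate k s)) g' = monomial (cluster s) g * (1 + y_hat s $ k) powi (g' $ k)"
proof -
  let ?x = "cluster s" and ?p = "\<lambda>i. pos (- b i k)"
  have split: "(\<Prod>i<m. f i) = f k * (\<Prod>i\<in>{..<m} - {k}. f i)" for f :: "nat \<Rightarrow> 'f"
    using k_less by (intro prod.remove) auto
  have "monomial (cluster (mutate k s)) g' =
      cluster (mutate k s) $ k powi (g' $ k) * (\<Prod>i\<in>{..<m} - {k}. ?x $ i powi (g' $ i))"
    using g' by (simp add: monomial_def split mutated_cluster(1))
  also have "cluster (mutate k s) $ k powi (g' $ k) = ?x $ k powi (g $ k) *
      (\<Prod>i\<in>{..<m} - {k}. ?x $ i powi (?p i * g' $ k)) * (1 + y_hat s $ k) powi (g' $ k)"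
  proof -
    \<comment> \<open>Since b_kk = 0, variable \<open>k\<close> does not occur in the exchange
      monomial.\<close>
    have "monomial ?x (vec m ?p) = (\<Prod>i\<in>{..<m} - {k}. ?x $ i powi (?p i))"
      using k_less b_diagonal by (simp add: monomial_def split)
    then show ?thesis
      by (simp add: mutated_cluster(2) g_k power_int_mult_distrib power_int_minus power_int_inverse
          prod_power_int power_int_mult)
  qed
  also have "\<dots> * (\<Prod>i\<in>{..<m} - {k}. ?x $ i powi (g' $ i)) =
      ?x $ k powi (g $ k) * (\<Prod>i\<in>{..<m} - {k}. ?x $ i powi (?p i * g' $ k) * ?x $ i powi (g' $ i)) *
      (1 + y_hat s $ k) powi (g' $ k)"
    by (simp add: prod.distrib mult_ac)
  also have "(\<Prod>i\<in>{..<m} - {k}. ?x $ i powi (?p i * g' $ k) * ?x $ i powi (g' $ i)) =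
      (\<Prod>i\<in>{..<m} - {k}. ?x $ i powi (g $ i))"
    using cluster_nonzero by (intro prod.cong) (auto simp: g_i power_int_add mult.commute)
  also have "?x $ k powi (g $ k) * (\<Prod>i\<in>{..<m} - {k}. ?x $ i powi (g $ i)) = monomial ?x g"
    using g by (simp add: monomial_def split)
  finally show ?thesis .
qed

lemma monomial_mutated_g_vector:
  assumes g: "g \<in> carrier_vec m" and g': "g' \<in> carrier_vec m"
    and compat: "compatible_g_vectors k (ext_matrix s) g g'"
  shows "monomial (cluster (mutate k s)) g' = monomial (cluster s) g *
    (y_hat s $ k powi pos (g $ k) * (1 + y_hat s $ k) powi (- g $ k))"
proof -
  \<comment> \<open>This multiple of column \<open>k\<close> absorbs the term with
    \<open>pos (g $ k)\<close> of the g-vector rule, leaving the linear relation of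
    \<open>monomial_mutated\<close>; it accounts for the power of
    \<open>y_hat s $ k\<close>.\<close>
  let ?h = "g + pos (g $ k) \<cdot>\<^sub>v col (ext_matrix s) k"
  have c: "col (ext_matrix s) k \<in> carrier_vec m"
    by (simp add: carrier_vecI)
  have "monomial (cluster (mutate k s)) g' =
      monomial (cluster s) ?h * (1 + y_hat s $ k) powi (g' $ k)"
    using g g' c compat k k_less b_diagonal
    by (intro monomial_mutated) (auto simp: compatible_g_vectors_def)
  also have "monomial (cluster s) ?h = monomial (cluster s) g * y_hat s $ k powi pos (g $ k)"
    using g c k by (simp add: monomial_add[OF cluster_nonzero] monomial_smult[OF cluster_nonzero]
        y_hat_as_monomial)
  also have "g' $ k = - g $ k"
    using compat by (simp add: compatible_g_vectors_def)
  finally show ?thesis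
    by (simp add: mult_ac)
qed

text \<open>Column \<open>j\<close> mutates by the g-vector rule with \<open>b k j\<close> in the
  place of \<open>g $ k\<close>, so the same shift by a multiple of column \<open>k\<close>
  applies.\<close>

lemma mutated_y_hat:
  assumes j: "j < n" "j \<noteq> k"
  shows "y_hat (mutate k s) $ j =
    y_hat s $ j * y_hat s $ k powi pos (b k j) * (1 + y_hat s $ k) powi (- b k j)"
proof -
  let ?h = "col (ext_matrix s) j + pos (b k j) \<cdot>\<^sub>v col (ext_matrix s) k"
  let ?g = "col (ext_matrix (mutate k s)) j"
  have c: "col (ext_matrix s) i \<in> carrier_vec m" for i
    by (simp add: carrier_vecI)
  have entry: "?g $ i = (if i = k then - b i j else b i j + b i k * pos (b k j) + pos (- b i k) * b k j)"
    if "i < m" for i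
    using mutated_entry[OF that j(1)] that j by simp
  have "y_hat (mutate k s) $ j = monomial (cluster (mutate k s)) ?g"
    using j by (simp add: y_hat_def)
  also have "\<dots> = monomial (cluster s) ?h * (1 + y_hat s $ k) powi (?g $ k)"
  proof (rule monomial_mutated)
    show "?g \<in> carrier_vec m" "?h \<in> carrier_vec m"
      using c by (auto intro: carrier_vecI)
    show "?h $ k = - ?g $ k"
      using entry[OF k_less] k k_less j b_diagonal by simp
    show "?h $ i = ?g $ i + pos (- b i k) * ?g $ k" if "i < m" "i \<noteq> k" for i
      using entry[OF that(1)] entry[OF k_less] that k j by (simp add: col_entry del: index_col)
  qed
  also have "monomial (cluster s) ?h = y_hat s $ j * y_hat s $ k powi pos (b k j)"
    using c k j by (simp add: monomial_add[OF cluster_nonzero] monomial_smult[OF cluster_nonzero]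
        y_hat_as_monomial)
  finally show ?thesis
    using entry[OF k_less] by simp
qed

text \<open>Column \<open>k\<close> merely changes sign, and its entry in row \<open>k\<close> is 0,
  so no power of \<open>1 + y_hat s $ k\<close> appears.\<close>

lemma mutated_y_hat_self: "y_hat (mutate k s) $ k = inverse (y_hat s $ k)"
proof -
  let ?h = "(- 1) \<cdot>\<^sub>v col (ext_matrix s) k"
  let ?g = "col (ext_matrix (mutate k s)) k"
  have c: "col (ext_matrix s) k \<in> carrier_vec m"
    by (simp add: carrier_vecI)
  have entry: "?g $ i = - b i k" if "i < m" for i
    using mutated_entry[OF that k] that k by simp
  have "y_hat (mutate k s) $ k = monomial (cluster (mutate k s)) ?g"
    using k by (simp add: y_hat_def)
  also have "\<dots> = monomial (cluster s) ?h * (1 + y_hat s $ k) powi (?g $ k)"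
    using entry k k_less c b_diagonal
    by (intro monomial_mutated) (auto intro: carrier_vecI simp: col_entry simp del: index_col)
  also have "\<dots> = inverse (y_hat s $ k)"
    using entry[OF k_less] b_diagonal c k
    by (simp add: monomial_smult[OF cluster_nonzero] y_hat_as_monomial power_int_minus)
  finally show ?thesis .
qed

text \<open>The conditions on \<open>r'\<close> tropicalize the mutation of \<open>y_hat\<close>:
  when \<open>y_hat s\<close> has degrees \<open>r\<close>, the mutated variables have degrees
  \<open>r'\<close>. The degree of \<open>F\<close> at \<open>y_hat s\<close> is computed directly
  and through \<open>F'\<close>.\<close>

lemma trop_mutation:
  assumes gF: "pointed_with s u g F" and gF': "pointed_with (mutate k s) u g' F'"
    and compat: "compatible_g_vectors k (ext_matrix s) g g'"
    and F: "\<And>v. v \<in> Poly_Mapping.keys F \<Longrightarrow> Poly_Mapping.lookup F v > 0"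
    and F': "\<And>v. v \<in> Poly_Mapping.keys F' \<Longrightarrow> Poly_Mapping.lookup F' v > 0"
    and r: "r \<in> carrier_vec n" and r': "r' \<in> carrier_vec n" and r_k: "r' $ k = - r $ k"
    and r_j: "\<And>j. j < n \<Longrightarrow> j \<noteq> k \<Longrightarrow> r' $ j = r $ j + pos (b k j) * r $ k - b k j * pos (r $ k)"
  shows "trop F r = pos (g $ k) * r $ k - g $ k * pos (r $ k) + trop F' r'"
proof -
  interpret subtraction_free "y_hat s" n r
    using r by (rule subtraction_free_y_hat)
  let ?td = "tropical_degree (y_hat s) r"
  have nonzero: "F \<noteq> 0" "F' \<noteq> 0"
    using gF gF' by (auto simp: pointed_with_def)
  have y_k: "?td (y_hat s $ k) (r $ k)"
    using k by (rule tropical_degree_var)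
  have one_plus: "?td (1 + y_hat s $ k) (pos (r $ k))"
    using tropical_degree_add[OF y_k tropical_degree_one] by (simp add: add.commute)
  have "?td (y_hat (mutate k s) $ j) (r' $ j)" if "j < n" for j
  proof (cases "j = k")
    case True
    then show ?thesis
      using tropical_degree_inverse[OF y_k] by (simp add: mutated_y_hat_self r_k)
  next
    case False
    then show ?thesis
      using tropical_degree_mult[OF tropical_degree_mult[OF tropical_degree_var[OF that]
          tropical_degree_powi[OF y_k]] tropical_degree_powi[OF one_plus], of "pos (b k j)" "- b k j"]
      by (simp add: mutated_y_hat r_j that)
  qed
  then have "?td (poly_eval of_int (y_hat (mutate k s)) F') (trop F' r')"
    using mutated.y_hat_carrier r' nonzero F' by (intro tropical_degree_poly_eval) auto
  then have "?td (y_hat s $ k powi pos (g $ k) * (1 + y_hat s $ k) powi (- g $ k) *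
      poly_eval of_int (y_hat (mutate k s)) F')
      (pos (g $ k) * r $ k + - g $ k * pos (r $ k) + trop F' r')"
    by (intro tropical_degree_mult tropical_degree_powi y_k one_plus)
  moreover have "y_hat s $ k powi pos (g $ k) * (1 + y_hat s $ k) powi (- g $ k) *
      poly_eval of_int (y_hat (mutate k s)) F' = poly_eval of_int (y_hat s) F"
  proof -
    have g: "g \<in> carrier_vec m" "g' \<in> carrier_vec m"
      using gF gF' by (auto simp: pointed_with_def)
    \<comment> \<open>Both pointed expressions represent \<open>u\<close>; the cluster monomial of
      \<open>g\<close> is non-zero and cancels.\<close>
    have "monomial (cluster s) g * poly_eval of_int (y_hat s) F =
        monomial (cluster (mutate k s)) g' * poly_eval of_int (y_hat (mutate k s)) F'"
      using gF gF' by (simp add: pointed_with_def)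
    also have "\<dots> = monomial (cluster s) g * (y_hat s $ k powi pos (g $ k) *
        (1 + y_hat s $ k) powi (- g $ k) * poly_eval of_int (y_hat (mutate k s)) F')"
      by (simp add: monomial_mutated_g_vector[OF g compat] mult_ac)
    finally show ?thesis
      using monomial_nonzero[OF cluster_nonzero g(1)] by simp
  qed
  moreover have "?td (poly_eval of_int (y_hat s) F) (trop F r)"
    using y_hat_carrier r nonzero F tropical_degree_var by (intro tropical_degree_poly_eval) auto
  ultimately show ?thesis
    using tropical_degree_unique by fastforce
qed

text \<open>The tropical mutation of \<open>r\<close> involves row \<open>k\<close> of the exchange
  matrix, the g-vector rule column \<open>k\<close>. For \<open>r = S h\<close> the skew-symmetrizer
  exchanges the two.\<close>

lemma trop_mutation_symmetrized:
  assumes S: "skew_symmetrizer S (exchange_matrix s)"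
    and gF: "pointed_with s u g F" and gF': "pointed_with (mutate k s) u g' F'"
    and compat: "compatible_g_vectors k (ext_matrix s) g g'"
    and F: "\<And>v. v \<in> Poly_Mapping.keys F \<Longrightarrow> Poly_Mapping.lookup F v > 0"
    and F': "\<And>v. v \<in> Poly_Mapping.keys F' \<Longrightarrow> Poly_Mapping.lookup F' v > 0"
    and compat': "compatible_g_vectors k (ext_matrix s) h h'"
  shows "trop F' (S *\<^sub>v vec_first h' n) - trop F (S *\<^sub>v vec_first h n) =
    S $$ (k, k) * (pos (- g' $ k) * pos (- h $ k) - pos (- g $ k) * pos (- h' $ k))"
proof -
  let ?r = "\<lambda>h. S *\<^sub>v vec_first h n"
  have S_n: "S \<in> carrier_mat n n" and S_pos: "\<And>j. j < n \<Longrightarrow> S $$ (j, j) > 0"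
      and diag: "diagonal_mat S"
    using S by (auto simp: skew_symmetrizer_def exchange_matrix_def)
  have r: "?r h $ j = S $$ (j, j) * h $ j" if "j < n" for h j
  proof -
    have "?r h $ j = (\<Sum>i<n. S $$ (j, i) * h $ i)"
      using mult_mat_vec_entry[OF S_n vec_first_carrier that] by (simp add: vec_first_def)
    also have "\<dots> = (\<Sum>i<n. if i = j then S $$ (j, j) * h $ j else 0)"
      using S_n diag that by (intro sum.cong) (auto simp: diagonal_mat_def)
    finally show ?thesis
      using that by simp
  qed
  have scale: "pos (a * c) = a * pos c" if "a > 0" for a c
    using that by (simp add: max_def mult_le_0_iff)
  have pos_r: "pos (?r h $ k) = S $$ (k, k) * pos (h $ k)"
    by (simp add: r k scale S_pos)
  have trop: "trop F (?r h) =
      pos (g $ k) * ?r h $ k - g $ k * pos (?r h $ k) + trop F' (?r h')"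
  proof (rule trop_mutation[OF gF gF' compat F F'])
    show "?r h' $ k = - ?r h $ k"
      using compat' k by (simp add: r compatible_g_vectors_def)
    show "?r h' $ j = ?r h $ j + pos (b k j) * ?r h $ k - b k j * pos (?r h $ k)"
      if j: "j < n" "j \<noteq> k" for j
    proof -
      have skew: "S $$ (k, k) * b k j = - (S $$ (j, j) * b j k)"
        using skew_symmetrizer_entry[OF S, of j k] j k by simp
      then have "S $$ (k, k) * b k j = S $$ (j, j) * (- b j k)"
        by simp
      \<comment> \<open>Positive factors pass through \<open>pos\<close>, so skew-symmetry also
        relates the positive parts.\<close>
      then have skew_pos: "S $$ (k, k) * pos (b k j) = S $$ (j, j) * pos (- b j k)"
        using scale[OF S_pos[OF k]] scale[OF S_pos[OF j(1)]] by metis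
      have "h' $ j = h $ j + pos (- b j k) * h $ k + b j k * pos (h $ k)"
        using compat' j n_le_m by (simp add: compatible_g_vectors_def)
      then have "?r h' $ j = S $$ (j, j) * h $ j + (S $$ (j, j) * pos (- b j k)) * h $ k
          - (- (S $$ (j, j) * b j k)) * pos (h $ k)"
        by (simp add: r j algebra_simps)
      then show ?thesis
        unfolding skew_pos[symmetric] skew[symmetric] pos_r by (simp add: r j k algebra_simps)
    qed
  qed (use S_n in auto)
  \<comment> \<open>After this substitution both sides equal
    \<open>S $$ (k, k) * (g $ k * pos (h $ k) - pos (g $ k) * h $ k)\<close>.\<close>
  have "g' $ k = - g $ k" "h' $ k = - h $ k"
    using compat compat' by (auto simp: compatible_g_vectors_def)
  then show ?thesis
    using trop[unfolded pos_r] by (simp add: r k pos_minus algebra_simps)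
qed

end

section \<open>Invariance along the tree\<close>

lemma labelled_regular_tree_arc:
  assumes "labelled_regular_tree n T lab" "(t, t') \<in> parcs T"
  shows "t \<in> pverts T" "t' \<in> pverts T" "lab (t, t') < n" "(t', t) \<in> parcs T"
proof -
  interpret sym_digraph "with_proj T"
    using assms(1) by (simp add: labelled_regular_tree_def)
  show t: "t \<in> pverts T" and "t' \<in> pverts T"
    using tail_in_verts[of "(t, t')"] head_in_verts[of "(t, t')"] assms(2) by auto
  have "(t, t') \<in> out_arcs (with_proj T) t"
    using assms(2) by (simp add: out_arcs_def)
  moreover have "bij_betw lab (out_arcs (with_proj T) t) {..<n}"
    using assms(1) t by (simp add: labelled_regular_tree_def)
  ultimately show "lab (t, t') < n"
    by (auto simp: bij_betw_def)
  show "(t', t) \<in> parcs T"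
    using sym_arcs assms(2) by (auto simp: symmetric_def dest: symD)
qed

text \<open>Arcs come in opposite pairs, so connectedness yields a directed walk from
  \<open>t\<close> to \<open>t'\<close>, along which the property is carried.\<close>

lemma labelled_regular_tree_induct [consumes 3, case_names base step]:
  assumes "labelled_regular_tree n T lab" "t \<in> pverts T" "t' \<in> pverts T"
    and "P t" and "\<And>v w. (v, w) \<in> parcs T \<Longrightarrow> P v \<Longrightarrow> P w"
  shows "P t'"
proof -
  interpret sym_digraph "with_proj T"
    using assms(1) by (simp add: labelled_regular_tree_def)
  have "strongly_connected (with_proj T)"
    using assms(1) sym_arcs symmetric_connected_imp_strongly_connected
    by (auto simp: labelled_regular_tree_def)
  then have "t \<rightarrow>\<^sup>*\<^bsub>with_proj T\<^esub> t'"
    using assms(2,3) by (simp add: strongly_connected_def)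
  then show ?thesis
    by (induction rule: reachable_induct) (use assms(4,5) in auto)
qed

text \<open>The rank is given at one vertex only; the trivial kernel obtained there spreads along
  the tree by mutation.\<close>

lemma cluster_pattern_full_rank_seed:
  assumes pattern: "cluster_pattern m n T lab X" and "n \<le> m" and "full_rank T X" and "t \<in> pverts T"
  shows "full_rank_seed m n (X t)"
proof -
  have tree: "labelled_regular_tree n T lab" and seeds: "\<And>t. t \<in> pverts T \<Longrightarrow> is_seed m n (X t)"
      and mutations: "\<And>t t'. (t, t') \<in> parcs T \<Longrightarrow> X t' = mutate (lab (t, t')) (X t)"
    using pattern by (auto simp: cluster_pattern_def)
  obtain t0 where t0: "t0 \<in> pverts T" and rank: "vec_space.rank (dim_row (ext_matrix (X t0)))
      (map_mat rat_of_int (ext_matrix (X t0))) = dim_col (ext_matrix (X t0))"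
    using assms(3) by (auto simp: full_rank_def)
  from tree t0 \<open>t \<in> pverts T\<close> have "mat_kernel (ext_matrix (X t)) = {0\<^sub>v n}"
  proof (induction rule: labelled_regular_tree_induct)
    case base
    have "ext_matrix (X t0) \<in> carrier_mat m n"
      using seeds[OF t0] by (simp add: is_seed_def)
    then show ?case
      using full_rank_mat_kernel rank by auto
  next
    case (step v w)
    then show ?case
      using mat_kernel_mutate[OF seeds _ _ step(2)] labelled_regular_tree_arc[OF tree step(1)]
        mutations[OF step(1)] assms(2) by simp
  qed
  then show ?thesis
    using seeds assms(4) by unfold_locales
qed

text \<open>Uniqueness identifies the definite descriptions \<open>ext_g_vector\<close> and
  \<open>F_polynomial\<close> with an actual witness of pointedness.\<close>

lemma good_pointed:
  assumes "good T lab X u" "t \<in> pverts T" "full_rank_seed m n (X t)"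
  shows "pointed_with (X t) u (ext_g_vector (X t) u) (F_polynomial (X t) u)"
    and "\<And>v. v \<in> Poly_Mapping.keys (F_polynomial (X t) u) \<Longrightarrow>
      Poly_Mapping.lookup (F_polynomial (X t) u) v > 0"
proof -
  obtain g F where gF: "pointed_with (X t) u g F"
    using assms(1,2) by (auto simp: good_def compatibly_pointed_def pointed_def)
  have "positive_Laurent (cluster (X t)) u"
    using assms(1,2) by (simp add: good_def)
  with gF show "pointed_with (X t) u (ext_g_vector (X t) u) (F_polynomial (X t) u)"
    and "\<And>v. v \<in> Poly_Mapping.keys (F_polynomial (X t) u) \<Longrightarrow>
      Poly_Mapping.lookup (F_polynomial (X t) u) v > 0"
    using full_rank_seed.pointed_with_iff[OF assms(3) gF]
      full_rank_seed.positive_Laurent_F_polynomial[OF assms(3) gF] by auto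
qed

lemma good_compatible_g_vectors:
  assumes "good T lab X u" "(t, t') \<in> parcs T"
  shows "compatible_g_vectors (lab (t, t')) (ext_matrix (X t))
    (ext_g_vector (X t) u) (ext_g_vector (X t') u)"
  using assms by (auto simp: good_def compatibly_pointed_def compatible_g_vectors_def Let_def)

lemma trop_F_polynomial_mutation:
  assumes pattern: "cluster_pattern m n T lab X" and "n \<le> m" and "full_rank T X"
    and S: "\<forall>t \<in> pverts T. skew_symmetrizer S (exchange_matrix (X t))"
    and u: "good T lab X u" and u': "good T lab X u'"
    and arc: "(t, t') \<in> parcs T" and lab: "k = lab (t, t')"
  shows "trop (F_polynomial (X t') u) (S *\<^sub>v g_vector (X t') u')
      - trop (F_polynomial (X t) u) (S *\<^sub>v g_vector (X t) u')
    = S $$ (k, k) * (pos (- ext_g_vector (X t') u $ k) * pos (- ext_g_vector (X t) u' $ k)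
      - pos (- ext_g_vector (X t) u $ k) * pos (- ext_g_vector (X t') u' $ k))"
proof -
  have tree: "labelled_regular_tree n T lab" and X': "X t' = mutate k (X t)"
    using pattern arc lab by (auto simp: cluster_pattern_def)
  note arcD = labelled_regular_tree_arc[OF tree arc]
  note full = cluster_pattern_full_rank_seed[OF assms(1,2,3)]
  interpret t: full_rank_seed m n "X t"
    by (rule full[OF arcD(1)])
  interpret t': full_rank_seed m n "X t'"
    by (rule full[OF arcD(2)])
  interpret full_rank_mutation m n "X t" k
    using arcD(3) lab assms(2) t'.seed by unfold_locales (auto simp: X')
  note pointed = good_pointed[OF u arcD(1) full[OF arcD(1)]] good_pointed[OF u arcD(2) full[OF arcD(2)]]
  have "S $$ (k, k) * (pos (- ext_g_vector (X t') u $ k) * pos (- ext_g_vector (X t) u' $ k)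
      - pos (- ext_g_vector (X t) u $ k) * pos (- ext_g_vector (X t') u' $ k)) =
      trop (F_polynomial (X t') u) (S *\<^sub>v vec_first (ext_g_vector (X t') u') n)
      - trop (F_polynomial (X t) u) (S *\<^sub>v vec_first (ext_g_vector (X t) u') n)"
    using S arcD(1) pointed good_compatible_g_vectors[OF u arc] good_compatible_g_vectors[OF u' arc]
    unfolding X' lab[symmetric] by (intro trop_mutation_symmetrized[symmetric]) auto
  then show ?thesis
    unfolding g_vector_def t.matrix_dims t'.matrix_dims by (rule sym)
qed

theorem theorem1p1:
  fixes m n :: nat
    and T :: "'v pair_pre_digraph" and lab :: "'v \<times> 'v \<Rightarrow> nat"
    and X :: "'v \<Rightarrow> 'f::field_char_0 seed"
    and S :: "int mat" and u u' :: 'f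
  assumes "0 < n" and "n \<le> m"
    and "cluster_pattern m n T lab X"
    and "full_rank T X"
    and "\<forall>t \<in> pverts T. skew_symmetrizer S (exchange_matrix (X t))"
    and "good T lab X u" and "good T lab X u'"
  shows "(\<forall>t t' k. (t, t') \<in> parcs T \<and> lab (t, t') = k \<longrightarrow>
            trop (F_polynomial (X t') u) (S *\<^sub>v g_vector (X t') u')
              - trop (F_polynomial (X t) u) (S *\<^sub>v g_vector (X t) u')
            = S $$ (k, k) *
              (pos (- ext_g_vector (X t') u $ k) * pos (- ext_g_vector (X t) u' $ k)
               - pos (- ext_g_vector (X t) u $ k) * pos (- ext_g_vector (X t') u' $ k)))
       \<and> (\<forall>t \<in> pverts T. \<forall>t' \<in> pverts T.
            trop (F_polynomial (X t) u) (S *\<^sub>v g_vector (X t) u')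
              + trop (F_polynomial (X t) u') (S *\<^sub>v g_vector (X t) u)
            = trop (F_polynomial (X t') u) (S *\<^sub>v g_vector (X t') u')
              + trop (F_polynomial (X t') u') (S *\<^sub>v g_vector (X t') u))
       \<and> (\<exists>c. \<forall>t \<in> pverts T. F_invariant S (X t) u u' = c)"
proof -
  have edge: "trop (F_polynomial (X t') w) (S *\<^sub>v g_vector (X t') w')
      - trop (F_polynomial (X t) w) (S *\<^sub>v g_vector (X t) w')
    = S $$ (k, k) * (pos (- ext_g_vector (X t') w $ k) * pos (- ext_g_vector (X t) w' $ k)
      - pos (- ext_g_vector (X t) w $ k) * pos (- ext_g_vector (X t') w' $ k))"
    if "good T lab X w" "good T lab X w'" "(t, t') \<in> parcs T" "lab (t, t') = k" for t t' k w w'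
    using trop_F_polynomial_mutation[OF assms(3,2,4,5) that(1-3) that(4)[symmetric]] .
  have tree: "labelled_regular_tree n T lab"
    using assms(3) by (simp add: cluster_pattern_def)
  have invariant: "F_invariant S (X t) u u' = F_invariant S (X t') u u'"
    if "t \<in> pverts T" "t' \<in> pverts T" for t t'
    using tree that
  proof (induction rule: labelled_regular_tree_induct)
    case (step v w)
    \<comment> \<open>The right-hand sides of (i) for the two orders of \<open>u\<close> and
      \<open>u'\<close> are opposite and cancel in the sum.\<close>
    then show ?case
      using edge[OF assms(6,7) step(1) refl] edge[OF assms(7,6) step(1) refl]
      by (simp add: F_invariant_def algebra_simps)
  qed simp
  then have "\<exists>c. \<forall>t \<in> pverts T. F_invariant S (X t) u u' = c"
    by metis
  then show ?thesis
    using edge[OF assms(6,7)] invariant unfolding F_invariant_def by blast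
qed

end
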